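(* Let $S=(R,\mu,\alpha,\beta)$ be a $(d,k,m)$ enhanced generalized Yang-Baxter operator, for any $m$ and $k$. Then the associated invariant $T_S$ of oriented links is projectively multiplicative: for any two oriented links $L_1,L_2$ with disjoint union $L_1\bigsqcup L_2$, $$T_S(L_1\bigsqcup L_2)=\mathrm{tr}(\mu)^{2m-k}\,T_S(L_1)\cdot T_S(L_2).$$
   Context: $V$ is a finite-dimensional complex vector space of dimension $d$; $I_m$ denotes the identity of $V^{\otimes m}$; $\mathrm{tr}$ is the ordinary trace of endomorphisms. $B_n$ is the braid group with generators $\sigma_1,\dots,\sigma_{n-1}$ and relations $\sigma_i\sigma_j=\sigma_j\sigma_i$ for $|i-j|\ge 2$, $\sigma_i\sigma_{i+1}\sigma_i=\sigma_{i+1}\sigma_i\sigma_{i+1}$ for $i=1,\dots,n-2$. Operator trace. For a basis $v_1,\dots,v_d$ of $V$ and $f\in\mathrm{End}(V^{\otimes k})$ write $f(v_{i_1}\otimes\cdots\otimes v_{i_k})=\sum f^{j_1,\dots,j_k}_{i_1,\dots,i_k}v_{j_1}\otimes\cdots\otimes v_{j_k}$. For $m<k$, $\mathrm{Sp}_{k,m}:\mathrm{End}(V^{\otimes k})\to\mathrm{End}(V^{\otimes (k-m)})$ is the partial trace over the last $m$ tensor factors: $\mathrm{Sp}_{k,m}(f)(v_{i_1}\otimes\cdots\otimes v_{i_{k-m}})=\sum_{j_1,\dots,j_{k-m},l_1,\dots,l_m}f^{j_1,\dots,j_{k-m},l_1,\dots,l_m}_{i_1,\dots,i_{k-m},l_1,\dots,l_m}v_{j_1}\otimes\cdots\otimes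 v_{j_{k-m}}$ (independent of the basis). Generalized Yang-Baxter operator (gYB-operator) of type $(d,k,m)$: an isomorphism $R:V^{\otimes k}\to V^{\otimes k}$, $\dim V=d$, with $(R\otimes I_m)(I_m\otimes R)(R\otimes I_m)=(I_m\otimes R)(R\otimes I_m)(I_m\otimes R)$ and $(R\otimes I_m^{\otimes(j-2)})(I_m^{\otimes(j-2)}\otimes R)=(I_m^{\otimes(j-2)}\otimes R)(R\otimes I_m^{\otimes(j-2)})$ for all $j\ge 4$. It gives a representation $\rho^R_n:B_n\to\mathrm{End}(V^{\otimes k+m(n-2)})$, $\sigma_i\mapsto I_m^{\otimes(i-1)}\otimes R\otimes I_m^{\otimes(n-i-1)}$, with image $\mathrm{im}(\rho^R_n)$. Perpendicular subspace: for a vector space $W$ and $A\subset\mathrm{End}(W)$, $A^\perp=\{g\in\mathrm{End}(W):\mathrm{tr}(f^*\circ g)=0\text{ for all }f\in A\}$, where $f^*$ is the hermitian conjugate of $f$ (for $W=V^{\otimes N}$, the conjugate transpose in the tensor basis induced by a fixed basis of $V$). Enhanced generalized Yang-Baxter operator (EgYB-operator) of type $(d,k,m)$: fix positive integers $k$ and $m$ with $m<k$. It is a collection $S=(R,\mu,\alpha,\beta)$ of a gYB-operator $R:V^{\otimes k}\to V^{\otimes k}$ of type $(d,k,m)$, a linear map $\mu:V\to V$, and invertible elements $\alpha,\beta$ of $\mathbb{C}$ such that, for all $n$: (i) $\mu^{\otimes k}$ commutes with $R$; (ii) $\mu^{\otimes m(n-1)}\otimes(\mathrm{Sp}_{k,m}(R\circ\mu^{\otimes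 k})-\alpha\beta\mu^{\otimes (k-m)})\in\mathrm{im}(\rho^R_n)^\perp$ and $\mu^{\otimes m(n-1)}\otimes(\mathrm{Sp}_{k,m}(R^{-1}\circ\mu^{\otimes k})-\alpha^{-1}\beta\mu^{\otimes (k-m)})\in\mathrm{im}(\rho^R_n)^\perp$. The invariant $T_S$: let $w:B_n\to\mathbb{Z}$ be the homomorphism with $w(\sigma_i)=1$ (number of positive crossings minus number of negative crossings). For $\xi\in B_n$, $T_S(\xi)=\alpha^{-w(\xi)}\beta^{-n}\,\mathrm{tr}\big(\rho^R_n(\xi)\circ\mu^{\otimes k+m(n-2)}\big)$. For an oriented link $L$, $T_S(L)=T_S(\xi)$ where $\xi$ is any braid whose closure is isotopic to $L$ (every oriented link is such a closure; $T_S$ is unchanged under the Markov moves $\xi\mapsto\eta^{-1}\xi\eta$, $\xi\mapsto\xi\sigma_n^{\pm1}$ for $\xi,\eta\in B_n$, so $T_S(L)$ is an isotopy invariant by Markov's theorem). If $L_1,L_2$ are closures of $\xi_1\in B_{n_1},\xi_2\in B_{n_2}$, then the disjoint union $L_1\bigsqcup L_2$ is the closure of the juxtaposition of $\xi_1$ and $\xi_2$ in $B_{n_1+n_2}$. *)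

theory Defs
  imports
    "HOL-Algebra.Group"
    "Jordan_Normal_Form.Schur_Decomposition"
    "Jordan_Normal_Form.Gauss_Jordan_Elimination"
begin

text \<open>
  \<^bold>\<open>Operators on tensor powers.\<close>
  With respect to a fixed basis of a complex vector space \<open>V\<close> of dimension \<open>d\<close>, an endomorphism of
  the \<open>N\<close>-th tensor power of \<open>V\<close> is a \<open>d ^ N \<times> d ^ N\<close> matrix acting on column vectors. The basis
  tensor \<open>v_{i_1} \<otimes> \<dots> \<otimes> v_{i_N}\<close> (with \<open>i_j < d\<close>) has as its index the number with base \<open>d\<close>
  digits \<open>i_1 \<dots> i_N\<close>, most significant digit first, so that tensor products of operators are
  Kronecker products.
\<close>

definition kron :: "complex mat \<Rightarrow> complex mat \<Rightarrow> complex mat" (infixr "\<otimes>\<^sub>m" 72) where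
  "A \<otimes>\<^sub>m B = mat (dim_row A * dim_row B) (dim_col A * dim_col B)
     (\<lambda>(i, j). A $$ (i div dim_row B, j div dim_col B) * B $$ (i mod dim_row B, j mod dim_col B))"

primrec tensor_power :: "complex mat \<Rightarrow> nat \<Rightarrow> complex mat" where
  "tensor_power A 0 = 1\<^sub>m 1"
| "tensor_power A (Suc n) = A \<otimes>\<^sub>m tensor_power A n"

text \<open>The identity of the \<open>N\<close>-th tensor power of \<open>V\<close>.\<close>

abbreviation tensor_id :: "nat \<Rightarrow> nat \<Rightarrow> complex mat" where
  "tensor_id d N \<equiv> 1\<^sub>m (d ^ N)"

definition mat_trace :: "complex mat \<Rightarrow> complex" where
  "mat_trace A = (\<Sum>i<dim_row A. A $$ (i, i))"

definition mat_inv :: "complex mat \<Rightarrow> complex mat" where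
  "mat_inv A = the (mat_inverse A)"

text \<open>The operator trace \<open>Sp_{k,m}\<close> over the last \<open>m\<close> tensor factors: the index \<open>i * d ^ m + l\<close>
  with \<open>l < d ^ m\<close> has the digits of \<open>i\<close> followed by the \<open>m\<close> digits of \<open>l\<close>.\<close>

definition partial_trace :: "nat \<Rightarrow> nat \<Rightarrow> nat \<Rightarrow> complex mat \<Rightarrow> complex mat" where
  "partial_trace d k m f = mat (d ^ (k - m)) (d ^ (k - m))
     (\<lambda>(j, i). \<Sum>l<d ^ m. f $$ (j * d ^ m + l, i * d ^ m + l))"

definition perp :: "nat \<Rightarrow> complex mat set \<Rightarrow> complex mat set" where
  "perp N A = {g \<in> carrier_mat N N. \<forall>f\<in>A. mat_trace (mat_adjoint f * g) = 0}"


text \<open>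
  \<^bold>\<open>Braid groups.\<close>
  The letter \<open>(i, True)\<close> stands for the generator \<open>\<sigma>_i\<close> and \<open>(i, False)\<close> for its inverse.
  Elements of the braid group on \<open>n\<close> strands are classes of words modulo the defining relations.
\<close>

type_synonym braid_word = "(nat \<times> bool) list"
type_synonym braid = "braid_word set"

definition braid_words :: "nat \<Rightarrow> braid_word set" where
  "braid_words n = lists ({1..<n} \<times> UNIV)"

inductive braid_eq :: "nat \<Rightarrow> braid_word \<Rightarrow> braid_word \<Rightarrow> bool" for n :: nat where
  refl: "u \<in> braid_words n \<Longrightarrow> braid_eq n u u"
| sym: "braid_eq n u v \<Longrightarrow> braid_eq n v u"
| trans: "braid_eq n u v \<Longrightarrow> braid_eq n v w \<Longrightarrow> braid_eq n u w"
| cong: "braid_eq n u u' \<Longrightarrow> braid_eq n v v' \<Longrightarrow> braid_eq n (u @ v) (u' @ v')"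
| cancel: "i \<in> {1..<n} \<Longrightarrow> braid_eq n [(i, b), (i, \<not> b)] []"
| far: "i \<in> {1..<n} \<Longrightarrow> j \<in> {1..<n} \<Longrightarrow> i + 2 \<le> j \<Longrightarrow>
    braid_eq n [(i, True), (j, True)] [(j, True), (i, True)]"
| braid: "i \<in> {1..<n} \<Longrightarrow> i + 1 \<in> {1..<n} \<Longrightarrow>
    braid_eq n [(i, True), (i + 1, True), (i, True)] [(i + 1, True), (i, True), (i + 1, True)]"

definition braid_class :: "nat \<Rightarrow> braid_word \<Rightarrow> braid" where
  "braid_class n u = {v. braid_eq n u v}"

definition braid_group :: "nat \<Rightarrow> braid monoid" where
  "braid_group n =
    \<lparr>carrier = braid_class n ` braid_words n,
     monoid.mult = (\<lambda>\<xi> \<eta>. {w. \<exists>u\<in>\<xi>. \<exists>v\<in>\<eta>. braid_eq n (u @ v) w}),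
     monoid.one = braid_class n []\<rparr>"

lemma braid_eq_words:
  assumes "braid_eq n u v"
  shows "u \<in> braid_words n" "v \<in> braid_words n"
  using assms by (induction rule: braid_eq.induct) (auto simp: braid_words_def)

lemma braid_class_mult:
  assumes "u \<in> braid_words n" "v \<in> braid_words n"
  shows "braid_class n u \<otimes>\<^bsub>braid_group n\<^esub> braid_class n v = braid_class n (u @ v)"
proof -
  have "braid_eq n (u @ v) w"
    if "braid_eq n u u'" "braid_eq n v v'" "braid_eq n (u' @ v') w" for u' v' w
    using braid_eq.trans[OF braid_eq.cong[OF that(1,2)] that(3)] .
  then show ?thesis
    using assms by (auto simp: braid_group_def braid_class_def intro: braid_eq.refl)
qed

lemma braid_class_eq: "braid_eq n u v \<Longrightarrow> braid_class n u = braid_class n v"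
  by (auto simp: braid_class_def intro: braid_eq.sym braid_eq.trans)

lemma braid_words_append [simp]:
  "u @ v \<in> braid_words n \<longleftrightarrow> u \<in> braid_words n \<and> v \<in> braid_words n"
  by (auto simp: braid_words_def)

lemma braid_words_Nil [simp]: "[] \<in> braid_words n"
  by (simp add: braid_words_def)

lemma braid_left_inverse:
  assumes "u \<in> braid_words n"
  shows "\<exists>v\<in>braid_words n. braid_eq n (v @ u) []"
  using assms
proof (induction u)
  case Nil
  then show ?case by (auto intro!: bexI[of _ "[]"] braid_eq.refl)
next
  case (Cons x u)
  obtain i b where x: "x = (i, b)" by force
  have i: "i \<in> {1..<n}" and u: "u \<in> braid_words n"
    using Cons.prems by (auto simp: braid_words_def x)
  obtain v where v: "v \<in> braid_words n" "braid_eq n (v @ u) []"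
    using Cons.IH[OF u] by blast
  have "braid_eq n [(i, \<not> b), (i, b)] []"
    using braid_eq.cancel[OF i, of "\<not> b"] by simp
  then have "braid_eq n (v @ [(i, \<not> b), (i, b)] @ u) (v @ [] @ u)"
    using v(1) u by (intro braid_eq.cong) (auto intro: braid_eq.refl)
  then have "braid_eq n ((v @ [(i, \<not> b)]) @ x # u) []"
    using v(2) braid_eq.trans by (fastforce simp: x)
  moreover have "v @ [(i, \<not> b)] \<in> braid_words n"
    using v(1) i by (auto simp: braid_words_def)
  ultimately show ?case by blast
qed

lemma braid_group_is_group: "group (braid_group n)"
proof (rule groupI)
  fix x assume "x \<in> carrier (braid_group n)"
  then obtain u where u: "u \<in> braid_words n" "x = braid_class n u"
    by (auto simp: braid_group_def)
  obtain v where v: "v \<in> braid_words n" "braid_eq n (v @ u) []"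
    using braid_left_inverse[OF u(1)] by blast
  have "braid_class n v \<otimes>\<^bsub>braid_group n\<^esub> x = \<one>\<^bsub>braid_group n\<^esub>"
    using braid_class_mult[OF v(1) u(1)] braid_class_eq[OF v(2)] u(2)
    by (simp add: braid_group_def)
  moreover have "braid_class n v \<in> carrier (braid_group n)"
    using v(1) by (simp add: braid_group_def)
  ultimately show "\<exists>y\<in>carrier (braid_group n). y \<otimes>\<^bsub>braid_group n\<^esub> x = \<one>\<^bsub>braid_group n\<^esub>"
    by blast
next
  have car: "carrier (braid_group n) = braid_class n ` braid_words n"
    and one: "\<one>\<^bsub>braid_group n\<^esub> = braid_class n []"
    by (simp_all add: braid_group_def)
  show "\<one>\<^bsub>braid_group n\<^esub> \<in> carrier (braid_group n)"
    by (auto simp: car one)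
  show "x \<otimes>\<^bsub>braid_group n\<^esub> y \<in> carrier (braid_group n)"
    if "x \<in> carrier (braid_group n)" "y \<in> carrier (braid_group n)" for x y
    using that by (auto simp: car braid_class_mult)
  show "x \<otimes>\<^bsub>braid_group n\<^esub> y \<otimes>\<^bsub>braid_group n\<^esub> z
      = x \<otimes>\<^bsub>braid_group n\<^esub> (y \<otimes>\<^bsub>braid_group n\<^esub> z)"
    if "x \<in> carrier (braid_group n)" "y \<in> carrier (braid_group n)"
      "z \<in> carrier (braid_group n)" for x y z
    using that by (auto simp: car braid_class_mult)
  show "\<one>\<^bsub>braid_group n\<^esub> \<otimes>\<^bsub>braid_group n\<^esub> x = x"
    if "x \<in> carrier (braid_group n)" for x
    using that by (auto simp: car one braid_class_mult)
qed

text \<open>The standard inclusion of \<open>B_n\<close> into \<open>B_{n+1}\<close>, and the juxtaposition of a braid in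
  \<open>B_{n_1}\<close> with a braid in \<open>B_{n_2}\<close>, which shifts the generators of the latter by \<open>n_1\<close>.\<close>

definition braid_incl :: "nat \<Rightarrow> braid \<Rightarrow> braid" where
  "braid_incl n \<xi> = {w. \<exists>u\<in>\<xi>. braid_eq (Suc n) u w}"

definition juxtapose :: "nat \<Rightarrow> nat \<Rightarrow> braid \<Rightarrow> braid \<Rightarrow> braid" where
  "juxtapose n1 n2 \<xi>1 \<xi>2 =
    {w. \<exists>u\<in>\<xi>1. \<exists>v\<in>\<xi>2. braid_eq (n1 + n2) (u @ map (\<lambda>(i, b). (i + n1, b)) v) w}"

definition word_writhe :: "braid_word \<Rightarrow> int" where
  "word_writhe u = (\<Sum>(i, b)\<leftarrow>u. if b then 1 else - 1)"

text \<open>In the next definition and in \<open>braid_rep\<close> the map on words is constant on each class, so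
  that \<open>the_elem\<close> picks its value on the class (for \<open>braid_rep\<close> when \<open>R\<close> is a
  gYB-operator).\<close>

definition writhe :: "braid \<Rightarrow> int" where
  "writhe \<xi> = the_elem (word_writhe ` \<xi>)"


text \<open>
  \<^bold>\<open>Oriented links.\<close>
  By the theorems of Alexander and Markov, closing braids identifies isotopy classes of oriented
  links with braids on any number \<open>n \<ge> 1\<close> of strands modulo the two Markov moves. A link is
  represented by the set of all braids whose closure it is.
\<close>

definition braids :: "(nat \<times> braid) set" where
  "braids = (SIGMA n:{1..}. carrier (braid_group n))"

inductive markov_eq :: "nat \<times> braid \<Rightarrow> nat \<times> braid \<Rightarrow> bool" where
  refl: "x \<in> braids \<Longrightarrow> markov_eq x x"
| sym: "markov_eq x y \<Longrightarrow> markov_eq y x"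
| trans: "markov_eq x y \<Longrightarrow> markov_eq y z \<Longrightarrow> markov_eq x z"
| conj: "n \<ge> 1 \<Longrightarrow> \<xi> \<in> carrier (braid_group n) \<Longrightarrow> \<eta> \<in> carrier (braid_group n) \<Longrightarrow>
    markov_eq (n, \<xi>)
      (n, inv\<^bsub>braid_group n\<^esub> \<eta> \<otimes>\<^bsub>braid_group n\<^esub> \<xi> \<otimes>\<^bsub>braid_group n\<^esub> \<eta>)"
| stab: "n \<ge> 1 \<Longrightarrow> \<xi> \<in> carrier (braid_group n) \<Longrightarrow>
    markov_eq (n, \<xi>)
      (Suc n, braid_incl n \<xi> \<otimes>\<^bsub>braid_group (Suc n)\<^esub> braid_class (Suc n) [(n, b)])"

type_synonym link = "(nat \<times> braid) set"

definition braid_closure :: "nat \<Rightarrow> braid \<Rightarrow> link" where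
  "braid_closure n \<xi> = {y. markov_eq (n, \<xi>) y}"

definition oriented_links :: "link set" where
  "oriented_links = {braid_closure n \<xi> | n \<xi>. n \<ge> 1 \<and> \<xi> \<in> carrier (braid_group n)}"

definition disjoint_union :: "link \<Rightarrow> link \<Rightarrow> link" where
  "disjoint_union L1 L2 =
    (\<Union>(n1, \<xi>1)\<in>L1. \<Union>(n2, \<xi>2)\<in>L2. braid_closure (n1 + n2) (juxtapose n1 n2 \<xi>1 \<xi>2))"


text \<open>\<^bold>\<open>Generalized Yang-Baxter operators.\<close>\<close>

definition gYB_operator :: "nat \<Rightarrow> nat \<Rightarrow> nat \<Rightarrow> complex mat \<Rightarrow> bool" where
  "gYB_operator d k m R \<longleftrightarrow>
    R \<in> carrier_mat (d ^ k) (d ^ k) \<and> invertible_mat R \<and>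
    (R \<otimes>\<^sub>m tensor_id d m) * (tensor_id d m \<otimes>\<^sub>m R) * (R \<otimes>\<^sub>m tensor_id d m) =
      (tensor_id d m \<otimes>\<^sub>m R) * (R \<otimes>\<^sub>m tensor_id d m) * (tensor_id d m \<otimes>\<^sub>m R) \<and>
    (\<forall>j\<ge>4.
      (R \<otimes>\<^sub>m tensor_id d (m * (j - 2))) * (tensor_id d (m * (j - 2)) \<otimes>\<^sub>m R) =
      (tensor_id d (m * (j - 2)) \<otimes>\<^sub>m R) * (R \<otimes>\<^sub>m tensor_id d (m * (j - 2))))"

text \<open>The number \<open>k + m (n - 2)\<close> of tensor factors on which \<open>B_n\<close> acts, written so that truncated
  subtraction gives \<open>k - m\<close> for \<open>n = 1\<close>.\<close>

definition rep_exp :: "nat \<Rightarrow> nat \<Rightarrow> nat \<Rightarrow> nat" where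
  "rep_exp k m n = k + m * n - 2 * m"

definition letter_rep :: "nat \<Rightarrow> nat \<Rightarrow> complex mat \<Rightarrow> nat \<Rightarrow> nat \<times> bool \<Rightarrow> complex mat" where
  "letter_rep d m R n = (\<lambda>(i, b).
     tensor_id d (m * (i - 1)) \<otimes>\<^sub>m (if b then R else mat_inv R) \<otimes>\<^sub>m tensor_id d (m * (n - i - 1)))"

definition word_rep :: "nat \<Rightarrow> nat \<Rightarrow> nat \<Rightarrow> complex mat \<Rightarrow> nat \<Rightarrow> braid_word \<Rightarrow> complex mat" where
  "word_rep d k m R n u = foldr (\<lambda>x A. letter_rep d m R n x * A) u (tensor_id d (rep_exp k m n))"

definition braid_rep :: "nat \<Rightarrow> nat \<Rightarrow> nat \<Rightarrow> complex mat \<Rightarrow> nat \<Rightarrow> braid \<Rightarrow> complex mat" where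
  "braid_rep d k m R n \<xi> = the_elem (word_rep d k m R n ` \<xi>)"

definition EgYB_operator ::
  "nat \<Rightarrow> nat \<Rightarrow> nat \<Rightarrow> complex mat \<Rightarrow> complex mat \<Rightarrow> complex \<Rightarrow> complex \<Rightarrow> bool" where
  "EgYB_operator d k m R \<mu> \<alpha> \<beta> \<longleftrightarrow>
    0 < m \<and> m < k \<and> gYB_operator d k m R \<and> \<mu> \<in> carrier_mat d d \<and> \<alpha> \<noteq> 0 \<and> \<beta> \<noteq> 0 \<and>
    tensor_power \<mu> k * R = R * tensor_power \<mu> k \<and>
    (\<forall>n\<ge>1.
      tensor_power \<mu> (m * (n - 1)) \<otimes>\<^sub>m
        (partial_trace d k m (R * tensor_power \<mu> k)
          - (\<alpha> * \<beta>) \<cdot>\<^sub>m tensor_power \<mu> (k - m))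
        \<in> perp (d ^ rep_exp k m n) (braid_rep d k m R n ` carrier (braid_group n)) \<and>
      tensor_power \<mu> (m * (n - 1)) \<otimes>\<^sub>m
        (partial_trace d k m (mat_inv R * tensor_power \<mu> k)
          - (inverse \<alpha> * \<beta>) \<cdot>\<^sub>m tensor_power \<mu> (k - m))
        \<in> perp (d ^ rep_exp k m n) (braid_rep d k m R n ` carrier (braid_group n)))"

definition T_braid :: "nat \<Rightarrow> nat \<Rightarrow> nat \<Rightarrow> complex mat \<Rightarrow> complex mat \<Rightarrow> complex \<Rightarrow> complex \<Rightarrow>
    nat \<Rightarrow> braid \<Rightarrow> complex" where
  "T_braid d k m R \<mu> \<alpha> \<beta> n \<xi> =
    \<alpha> powi (- writhe \<xi>) * \<beta> powi (- int n) *
    mat_trace (braid_rep d k m R n \<xi> * tensor_power \<mu> (rep_exp k m n))"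

text \<open>\<open>T\<close> is the invariant of oriented links associated with \<open>(R, \<mu>, \<alpha>, \<beta>)\<close>: the value at a link
  is the value of \<open>T_braid\<close> at any braid whose closure is that link. This determines \<open>T\<close> on all
  oriented links; such a \<open>T\<close> exists iff \<open>T_braid\<close> is unchanged under the Markov moves.\<close>

definition associated_invariant :: "nat \<Rightarrow> nat \<Rightarrow> nat \<Rightarrow> complex mat \<Rightarrow> complex mat \<Rightarrow>
    complex \<Rightarrow> complex \<Rightarrow> (link \<Rightarrow> complex) \<Rightarrow> bool" where
  "associated_invariant d k m R \<mu> \<alpha> \<beta> T \<longleftrightarrow>
    (\<forall>n\<ge>1. \<forall>\<xi>\<in>carrier (braid_group n).
       T (braid_closure n \<xi>) = T_braid d k m R \<mu> \<alpha> \<beta> n \<xi>)"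

end

theory Submission
  imports Defs
begin

text \<open>
  Let \<open>u \<in> B_{n_1}\<close> and \<open>v \<in> B_{n_2}\<close> be braids with closures \<open>L_1\<close> and \<open>L_2\<close>, and write
  \<open>tr_\<mu>(\<xi>)\<close> for the trace of \<open>\<rho>(\<xi>)\<close> composed with the tensor power of \<open>\<mu>\<close>. The writhe and the
  number of strands are additive under juxtaposition, so the theorem is a statement about \<open>tr_\<mu>\<close>
  of \<open>u\<close> placed to the left of \<open>v\<close>.

  Such a braid acts on \<open>k + m (n_1 + n_2 - 2)\<close> tensor factors; \<open>u\<close> uses the first
  \<open>k + m (n_1 - 2)\<close> of them and \<open>v\<close> the last \<open>k + m (n_2 - 2)\<close>. If \<open>k \<le> 2 m\<close>, these two blocks are
  disjoint and leave \<open>2 m - k\<close> factors between them on which only \<open>\<mu>\<close> acts, so the trace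
  factors and the middle contributes \<open>tr(\<mu>)^(2 m - k)\<close>.

  If \<open>k > 2 m\<close>, the blocks overlap. Insert \<open>p\<close> trivial strands between \<open>u\<close> and \<open>v\<close>, with \<open>p\<close> large
  enough that the blocks become disjoint with \<open>m p + 2 m - k\<close> factors between them
  (\<open>weighted_trace_split\<close>). If the trivial strands stand to the right of both \<open>u\<close> and \<open>v\<close> instead,
  they multiply the trace by \<open>tr(\<mu>)^(m p)\<close> (\<open>weighted_trace_add_strands\<close>). Both braids have the
  same closure, so the two traces agree, and since \<open>tr(\<mu>) \<noteq> 0\<close> the factor \<open>tr(\<mu>)^(m p)\<close> can be
  cancelled (\<open>weighted_trace_juxtaposition\<close>). Invariance under Markov moves is part of the
  hypothesis that \<open>T\<close> is a function on links.

  Moving trivial strands past \<open>v\<close> is an instance of the fact that \<open>u\<close> beside \<open>v\<close> and \<open>v\<close> beside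
  \<open>u\<close> are conjugate. A conjugating braid is a power of the Coxeter braid
  \<open>\<sigma>_1 \<dots> \<sigma>_{n-1}\<close>, which rotates the strands cyclically (\<open>juxtaposition_swap\<close>). The same fact
  shows that the Markov class of a juxtaposition depends only on the Markov classes of both
  pieces (\<open>markov_eq_juxtapose\<close>), so that the disjoint union of two links is the closure of a
  single braid (\<open>disjoint_union_closure\<close>) and \<open>T\<close> can be evaluated on it.
\<close>

lemmas [trans] = braid_eq.trans markov_eq.trans

section \<open>Kronecker products\<close>

lemma kron_dim [simp]:
  "dim_row (A \<otimes>\<^sub>m B) = dim_row A * dim_row B" "dim_col (A \<otimes>\<^sub>m B) = dim_col A * dim_col B"
  by (simp_all add: kron_def)

lemma kron_carrier [simp, intro]:
  "A \<in> carrier_mat a b \<Longrightarrow> B \<in> carrier_mat c e \<Longrightarrow> A \<otimes>\<^sub>m B \<in> carrier_mat (a * c) (b * e)"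
  by (simp add: kron_def)

lemma kron_index:
  "i < dim_row A * dim_row B \<Longrightarrow> j < dim_col A * dim_col B \<Longrightarrow>
    (A \<otimes>\<^sub>m B) $$ (i, j) = A $$ (i div dim_row B, j div dim_col B) * B $$ (i mod dim_row B, j mod dim_col B)"
  by (simp add: kron_def)

lemma div_mod_bounds:
  fixes i a b :: nat
  assumes "i < a * b"
  shows "i div b < a" "i mod b < b"
proof -
  have "0 < b" using assms by (cases b) auto
  then show "i div b < a" "i mod b < b"
    using assms by (auto simp: less_mult_imp_div_less)
qed

lemma kron_assoc: "(A \<otimes>\<^sub>m B) \<otimes>\<^sub>m C = A \<otimes>\<^sub>m (B \<otimes>\<^sub>m C)"
proof (rule eq_matI)
  fix i j
  assume ij: "i < dim_row (A \<otimes>\<^sub>m (B \<otimes>\<^sub>m C))" "j < dim_col (A \<otimes>\<^sub>m (B \<otimes>\<^sub>m C))"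
  then have i: "i < (dim_row A * dim_row B) * dim_row C" "i < dim_row A * (dim_row B * dim_row C)"
    and j: "j < (dim_col A * dim_col B) * dim_col C" "j < dim_col A * (dim_col B * dim_col C)"
    by (simp_all add: mult.assoc)
  \<comment> \<open>Cutting an index into three digits gives the same digits from either end.\<close>
  have split: "x div c div b = x div (b * c)" "x div c mod b = x mod (b * c) div c"
    "x mod (b * c) mod c = x mod c" if "x < a * (b * c)" for x a b c :: nat
  proof -
    have "0 < c" using that by (cases c) auto
    then show "x div c div b = x div (b * c)" "x div c mod b = x mod (b * c) div c"
      "x mod (b * c) mod c = x mod c"
      by (simp_all add: div_mult2_eq mod_mult2_eq mult.commute[of b c])
  qed
  show "((A \<otimes>\<^sub>m B) \<otimes>\<^sub>m C) $$ (i, j) = (A \<otimes>\<^sub>m (B \<otimes>\<^sub>m C)) $$ (i, j)"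
    using div_mod_bounds[OF i(1)] div_mod_bounds[OF i(2)] div_mod_bounds[OF j(1)]
      div_mod_bounds[OF j(2)] i j
    by (simp add: kron_index split[OF i(2)] split[OF j(2)])
qed (simp_all add: mult.assoc)

text \<open>A pair of digits runs over a rectangle as the index runs over an interval; both the trace and
  the entries of a product of Kronecker products factor because of this.\<close>
lemma sum_div_mod:
  "(\<Sum>l<a * b. f (l div b) (l mod b)) = (\<Sum>x<a. \<Sum>y<b. f x y)" for a b :: nat
proof -
  have "(\<Sum>x<a. \<Sum>y<b. f x y) = (\<Sum>x<a. \<Sum>l = x * b..<x * b + b. f (l div b) (l mod b))"
  proof (rule sum.cong[OF HOL.refl])
    fix x
    have "(\<Sum>l = 0 + x * b..<b + x * b. f (l div b) (l mod b))
      = (\<Sum>y = 0..<b. f ((y + x * b) div b) ((y + x * b) mod b))"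
      by (rule sum.shift_bounds_nat_ivl)
    also have "\<dots> = (\<Sum>y<b. f x y)"
      by (intro sum.cong) auto
    finally show "(\<Sum>y<b. f x y) = (\<Sum>l = x * b..<x * b + b. f (l div b) (l mod b))"
      by (simp add: add.commute)
  qed
  then show ?thesis
    by (simp add: sum.nat_group)
qed

lemma kron_mult:
  assumes "dim_col A = dim_row C" "dim_col B = dim_row D"
  shows "(A \<otimes>\<^sub>m B) * (C \<otimes>\<^sub>m D) = (A * C) \<otimes>\<^sub>m (B * D)"
proof (rule eq_matI)
  fix i j
  assume "i < dim_row ((A * C) \<otimes>\<^sub>m (B * D))" "j < dim_col ((A * C) \<otimes>\<^sub>m (B * D))"
  then have i: "i < dim_row A * dim_row B" and j: "j < dim_col C * dim_col D"
    by simp_all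
  let ?p = "i div dim_row B" and ?q = "i mod dim_row B"
  let ?r = "j div dim_col D" and ?s = "j mod dim_col D"
  note b = div_mod_bounds[OF i] div_mod_bounds[OF j]
  have "((A \<otimes>\<^sub>m B) * (C \<otimes>\<^sub>m D)) $$ (i, j)
      = (\<Sum>l<dim_row C * dim_row D. (A \<otimes>\<^sub>m B) $$ (i, l) * (C \<otimes>\<^sub>m D) $$ (l, j))"
    using i j assms by (simp add: scalar_prod_def lessThan_atLeast0)
  also have "\<dots> = (\<Sum>l<dim_row C * dim_row D.
      (\<lambda>x y. (A $$ (?p, x) * C $$ (x, ?r)) * (B $$ (?q, y) * D $$ (y, ?s)))
        (l div dim_row D) (l mod dim_row D))"
    using i j assms by (intro sum.cong) (simp_all add: kron_index)
  also have "\<dots> = (\<Sum>x<dim_row C. \<Sum>y<dim_row D.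
      (A $$ (?p, x) * C $$ (x, ?r)) * (B $$ (?q, y) * D $$ (y, ?s)))"
    by (rule sum_div_mod)
  also have "\<dots> = (\<Sum>x<dim_row C. A $$ (?p, x) * C $$ (x, ?r)) *
      (\<Sum>y<dim_row D. B $$ (?q, y) * D $$ (y, ?s))"
    by (simp add: sum_product)
  also have "\<dots> = ((A * C) \<otimes>\<^sub>m (B * D)) $$ (i, j)"
    using i j b assms by (simp add: kron_index scalar_prod_def lessThan_atLeast0)
  finally show "((A \<otimes>\<^sub>m B) * (C \<otimes>\<^sub>m D)) $$ (i, j) = ((A * C) \<otimes>\<^sub>m (B * D)) $$ (i, j)" .
qed simp_all

lemma kron_one: "1\<^sub>m a \<otimes>\<^sub>m 1\<^sub>m b = 1\<^sub>m (a * b)"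
proof (rule eq_matI)
  fix i j
  assume "i < dim_row (1\<^sub>m (a * b) :: complex mat)" "j < dim_col (1\<^sub>m (a * b) :: complex mat)"
  then have i: "i < a * b" and j: "j < a * b"
    by simp_all
  have "i = j" if "i div b = j div b" "i mod b = j mod b"
    by (metis div_mult_mod_eq that)
  then show "(1\<^sub>m a \<otimes>\<^sub>m 1\<^sub>m b) $$ (i, j) = (1\<^sub>m (a * b) :: complex mat) $$ (i, j)"
    using div_mod_bounds[OF i] div_mod_bounds[OF j] i j by (auto simp: kron_index)
qed simp_all

lemma tensor_id_add: "tensor_id d (a + b) = tensor_id d a \<otimes>\<^sub>m tensor_id d b"
  by (simp add: kron_one power_add)

lemma kron_one_left [simp]: "1\<^sub>m 1 \<otimes>\<^sub>m A = A"
  by (rule eq_matI) (auto simp: kron_index)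

lemma mat_trace_kron:
  assumes "A \<in> carrier_mat a a" "B \<in> carrier_mat b b"
  shows "mat_trace (A \<otimes>\<^sub>m B) = mat_trace A * mat_trace B"
proof -
  have "mat_trace (A \<otimes>\<^sub>m B) =
      (\<Sum>i<a * b. (\<lambda>x y. A $$ (x, x) * B $$ (y, y)) (i div b) (i mod b))"
    using assms by (auto simp: mat_trace_def kron_index intro!: sum.cong)
  also have "\<dots> = (\<Sum>x<a. \<Sum>y<b. A $$ (x, x) * B $$ (y, y))"
    by (rule sum_div_mod)
  also have "\<dots> = mat_trace A * mat_trace B"
    using assms by (simp add: mat_trace_def sum_product)
  finally show ?thesis .
qed

lemma tensor_power_carrier [simp]:
  "\<mu> \<in> carrier_mat d d \<Longrightarrow> tensor_power \<mu> n \<in> carrier_mat (d ^ n) (d ^ n)"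
  by (induction n) auto

lemma tensor_power_add:
  "tensor_power \<mu> (a + b) = tensor_power \<mu> a \<otimes>\<^sub>m tensor_power \<mu> b"
  by (induction a) (simp_all add: kron_assoc kron_one_left[unfolded One_nat_def])

lemma mat_trace_tensor_power:
  assumes "\<mu> \<in> carrier_mat d d"
  shows "mat_trace (tensor_power \<mu> n) = mat_trace \<mu> ^ n"
proof (induction n)
  case 0
  then show ?case by (simp add: mat_trace_def)
next
  case (Suc n)
  then show ?case
    using mat_trace_kron[OF assms tensor_power_carrier[OF assms]] by simp
qed

text \<open>\<open>mat_inv\<close> takes \<open>the\<close> of an option, so before it can be used one has to know that
  Gauss-Jordan elimination succeeds on an invertible matrix.\<close>
lemma mat_inv_inverse:
  assumes "A \<in> carrier_mat n n" "invertible_mat A"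
  shows "mat_inv A \<in> carrier_mat n n" "A * mat_inv A = 1\<^sub>m n" "mat_inv A * A = 1\<^sub>m n"
proof -
  obtain B where B: "A * B = 1\<^sub>m n" "B * A = 1\<^sub>m (dim_row B)"
    using assms by (auto simp: invertible_mat_def inverts_mat_def)
  then have "B \<in> carrier_mat n n"
    using assms(1) by (metis carrier_matD carrier_matI index_mult_mat(2,3) index_one_mat(2,3))
  then have "A \<in> Units (ring_mat TYPE(complex) n ())"
    using assms(1) B by (auto simp: Units_def ring_mat_def)
  then obtain C where "mat_inverse A = Some C"
    using mat_inverse(1)[OF assms(1), of "()"] by (cases "mat_inverse A") auto
  then show "mat_inv A \<in> carrier_mat n n" "A * mat_inv A = 1\<^sub>m n" "mat_inv A * A = 1\<^sub>m n"
    using mat_inverse(2)[OF assms(1)] by (auto simp: mat_inv_def)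
qed

section \<open>The representation of braid words\<close>

lemma braid_eq_mono:
  assumes "braid_eq n u v" "n \<le> N"
  shows "braid_eq N u v"
  using assms
proof (induction rule: braid_eq.induct)
  case (refl u)
  then have "u \<in> braid_words N" by (auto simp: braid_words_def lists_eq_set)
  then show ?case by (rule braid_eq.refl)
next
  case (braid i)
  then show ?case using braid_eq.braid[of i N] by simp
qed (auto intro: braid_eq.intros)

text \<open>The words of the right-hand braid in a juxtaposition, named so that the renumbering of
  generators can be computed by rewriting.\<close>
definition shift :: "nat \<Rightarrow> braid_word \<Rightarrow> braid_word" where
  "shift s = map (\<lambda>(i, b). (i + s, b))"

lemma shift_simps [simp]:
  "shift s [] = []" "shift s (x # u) = (fst x + s, snd x) # shift s u"
  "shift s (u @ v) = shift s u @ shift s v" "shift s (shift t u) = shift (t + s) u" "shift 0 u = u"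
  by (auto simp: shift_def case_prod_beta)

lemma shift_words: "u \<in> braid_words n \<Longrightarrow> s + n \<le> N \<Longrightarrow> shift s u \<in> braid_words N"
  by (induction u) (auto simp: braid_words_def)

lemma braid_eq_shift:
  assumes "braid_eq n u v" "s + n \<le> N"
  shows "braid_eq N (shift s u) (shift s v)"
  using assms
proof (induction rule: braid_eq.induct)
  case (refl u)
  then show ?case by (auto intro: braid_eq.refl shift_words)
next
  case (braid i)
  then show ?case using braid_eq.braid[of "i + s" N] by simp
qed (auto intro: braid_eq.intros)

lemma braid_words_Cons:
  "(i, b) # u \<in> braid_words n \<longleftrightarrow> 1 \<le> i \<and> i < n \<and> u \<in> braid_words n"
  by (auto simp: braid_words_def)

lemma braid_words_mono: "u \<in> braid_words n \<Longrightarrow> n \<le> N \<Longrightarrow> u \<in> braid_words N"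
  by (auto simp: braid_words_def lists_eq_set)

locale gYB =
  fixes d k m :: nat and R :: "complex mat"
  assumes gYB: "gYB_operator d k m R" and m_less_k: "m < k"
begin

abbreviation tid :: "nat \<Rightarrow> complex mat" where "tid \<equiv> tensor_id d"
abbreviation width :: "nat \<Rightarrow> nat" where "width \<equiv> rep_exp k m"
abbreviation letter :: "nat \<Rightarrow> nat \<times> bool \<Rightarrow> complex mat" where "letter \<equiv> letter_rep d m R"
abbreviation rho :: "nat \<Rightarrow> braid_word \<Rightarrow> complex mat" where "rho \<equiv> word_rep d k m R"

definition gen :: "bool \<Rightarrow> complex mat" where
  "gen b = (if b then R else mat_inv R)"

lemma gen_carrier [simp]: "gen b \<in> carrier_mat (d ^ k) (d ^ k)"
  and gen_cancel: "gen b * gen (\<not> b) = tid k"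
  using mat_inv_inverse[of R "d ^ k"] gYB by (auto simp: gen_def gYB_operator_def)

lemma gen_dim [simp]: "dim_row (gen b) = d ^ k" "dim_col (gen b) = d ^ k"
  using gen_carrier[of b] unfolding carrier_mat_def by auto

lemma letter_eq: "letter n (i, b) = tid (m * (i - 1)) \<otimes>\<^sub>m gen b \<otimes>\<^sub>m tid (m * (n - i - 1))"
  by (simp add: letter_rep_def gen_def)

text \<open>Truncated subtraction in \<open>rep_exp\<close> is harmless when a generator exists, since then there are
  at least two strands.\<close>
lemma width_split:
  assumes "1 \<le> i" "i < n"
  shows "width n = m * (i - 1) + (k + m * (n - i - 1))"
proof -
  obtain j where "i = Suc j" using assms(1) by (cases i) auto
  moreover obtain r where "n = Suc (i + r)" using assms(2) less_iff_Suc_add by auto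
  ultimately show ?thesis by (simp add: rep_exp_def algebra_simps)
qed

lemma letter_carrier:
  "1 \<le> i \<Longrightarrow> i < n \<Longrightarrow> letter n (i, b) \<in> carrier_mat (d ^ width n) (d ^ width n)"
  by (simp add: letter_eq carrier_matI width_split power_add)

lemma rho_simps: "rho n [] = tid (width n)" "rho n (x # u) = letter n x * rho n u"
  by (simp_all add: word_rep_def)

lemma rho_carrier: "u \<in> braid_words n \<Longrightarrow> rho n u \<in> carrier_mat (d ^ width n) (d ^ width n)"
proof (induction u)
  case (Cons x u)
  then show ?case
    using letter_carrier[of "fst x" n "snd x"] by (cases x) (auto simp: rho_simps braid_words_Cons)
qed (simp add: rho_simps)

lemma rho_append:
  assumes "u \<in> braid_words n" "v \<in> braid_words n"
  shows "rho n (u @ v) = rho n u * rho n v"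
  using assms(1)
proof (induction u)
  case Nil
  then show ?case using rho_carrier[OF assms(2)] by (simp add: rho_simps)
next
  case (Cons x u)
  obtain i b where x: "x = (i, b)" by force
  with Cons.prems have i: "1 \<le> i" "i < n" and u: "u \<in> braid_words n"
    by (auto simp: braid_words_Cons)
  show ?case
    using Cons.IH[OF u]
      assoc_mult_mat[OF letter_carrier[OF i] rho_carrier[OF u] rho_carrier[OF assms(2)]]
    by (simp add: rho_simps x)
qed

text \<open>Two generators \<open>\<sigma>_i\<close> and \<open>\<sigma>_j\<close> are written with the same identity factors outside of the window
  of tensor factors that they touch together. On that window they become
  \<open>R \<otimes> I\<close> and \<open>I \<otimes> R\<close>, the form in which the Yang-Baxter relations are stated.\<close>
lemma letter_window:
  assumes "1 \<le> i" "i \<le> j" "j < n"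
  shows "letter n (i, b) = tid (m * (i - 1)) \<otimes>\<^sub>m (gen b \<otimes>\<^sub>m tid (m * (j - i))) \<otimes>\<^sub>m tid (m * (n - j - 1))"
    and "letter n (j, b) = tid (m * (i - 1)) \<otimes>\<^sub>m (tid (m * (j - i)) \<otimes>\<^sub>m gen b) \<otimes>\<^sub>m tid (m * (n - j - 1))"
proof -
  have "m * (n - i - 1) = m * (j - i) + m * (n - j - 1)"
    using assms by (simp flip: distrib_left)
  then show "letter n (i, b) =
      tid (m * (i - 1)) \<otimes>\<^sub>m (gen b \<otimes>\<^sub>m tid (m * (j - i))) \<otimes>\<^sub>m tid (m * (n - j - 1))"
    by (simp only: letter_eq tensor_id_add kron_assoc)
  have "m * (j - 1) = m * (i - 1) + m * (j - i)"
    using assms by (simp flip: distrib_left)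
  then show "letter n (j, b) =
      tid (m * (i - 1)) \<otimes>\<^sub>m (tid (m * (j - i)) \<otimes>\<^sub>m gen b) \<otimes>\<^sub>m tid (m * (n - j - 1))"
    by (simp only: letter_eq tensor_id_add kron_assoc)
qed

lemma window_mult:
  assumes "X \<in> carrier_mat (d ^ e) (d ^ e)" "Y \<in> carrier_mat (d ^ e) (d ^ e)"
  shows "(tid a \<otimes>\<^sub>m X \<otimes>\<^sub>m tid c) * (tid a \<otimes>\<^sub>m Y \<otimes>\<^sub>m tid c) = tid a \<otimes>\<^sub>m (X * Y) \<otimes>\<^sub>m tid c"
proof -
  have "dim_row X = d ^ e" "dim_col X = d ^ e" "dim_row Y = d ^ e" "dim_col Y = d ^ e"
    using assms by auto
  then show ?thesis by (simp add: kron_mult)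
qed

lemma rho_singleton: "1 \<le> i \<Longrightarrow> i < n \<Longrightarrow> rho n [(i, b)] = letter n (i, b)"
  using letter_carrier[of i n b] by (simp add: rho_simps)

lemma rho_cancel:
  assumes "1 \<le> i" "i < n"
  shows "rho n [(i, b), (i, \<not> b)] = rho n []"
proof -
  have "rho n [(i, b), (i, \<not> b)] = letter n (i, b) * letter n (i, \<not> b)"
    using letter_carrier[OF assms] rho_singleton[OF assms] by (simp add: rho_simps)
  also have "\<dots> = tid (m * (i - 1)) \<otimes>\<^sub>m tid k \<otimes>\<^sub>m tid (m * (n - i - 1))"
    by (simp add: letter_eq window_mult[of _ k] gen_cancel)
  also have "\<dots> = rho n []"
    by (simp only: rho_simps width_split[OF assms] tensor_id_add)
  finally show ?thesis .
qed

lemma rho_far: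
  assumes "1 \<le> i" "i + 2 \<le> j" "j < n"
  shows "rho n [(i, True), (j, True)] = rho n [(j, True), (i, True)]"
proof -
  let ?s = "j - i"
  have i: "1 \<le> i" "i < n" and j: "1 \<le> j" "j < n" and ij: "i \<le> j"
    using assms by auto
  have "(gen True \<otimes>\<^sub>m tid (m * ?s)) * (tid (m * ?s) \<otimes>\<^sub>m gen True)
      = (tid (m * ?s) \<otimes>\<^sub>m gen True) * (gen True \<otimes>\<^sub>m tid (m * ?s))"
  proof -
    \<comment> \<open>The far commutation of generators at distance \<open>s\<close> is indexed by \<open>j = s + 2\<close>.\<close>
    have "4 \<le> ?s + 2" "?s + 2 - 2 = ?s"
      using assms by simp_all
    then show ?thesis
      using gYB unfolding gYB_operator_def gen_def if_True by metis
  qed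
  then have "letter n (i, True) * letter n (j, True) = letter n (j, True) * letter n (i, True)"
    unfolding letter_window[OF assms(1) ij assms(3)]
    by (simp add: window_mult[of _ "k + m * ?s"] carrier_matI power_add mult.commute)
  then show ?thesis
    using rho_singleton[OF i] rho_singleton[OF j] by (simp add: rho_simps(2)[where u = "[_]"])
qed

lemma rho_braid:
  assumes "1 \<le> i" "Suc i < n"
  shows "rho n [(i, True), (Suc i, True), (i, True)] = rho n [(Suc i, True), (i, True), (Suc i, True)]"
proof -
  let ?A = "gen True \<otimes>\<^sub>m tid m" and ?B = "tid m \<otimes>\<^sub>m gen True"
  let ?x = "letter n (i, True)" and ?y = "letter n (Suc i, True)"
  have i: "1 \<le> i" "i < n" "i \<le> Suc i" and j: "1 \<le> Suc i" "Suc i < n"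
    using assms by auto
  have AB: "?A \<in> carrier_mat (d ^ (k + m)) (d ^ (k + m))" "?B \<in> carrier_mat (d ^ (k + m)) (d ^ (k + m))"
    by (simp_all add: carrier_matI power_add mult.commute)
  have YB: "?A * (?B * ?A) = ?B * (?A * ?B)"
  proof -
    have "?A * ?B * ?A = ?B * ?A * ?B"
      using gYB unfolding gYB_operator_def gen_def if_True by blast
    then show ?thesis
      using AB by (simp only: assoc_mult_mat)
  qed
  have "?x * (?y * ?x) = ?y * (?x * ?y)"
    using AB YB
    by (simp add: letter_window[OF i(1) i(3) assms(2)] window_mult[of _ "k + m"]
        mult_carrier_mat[of _ "d ^ (k + m)" "d ^ (k + m)"])
  then show ?thesis
    using rho_singleton[OF i(1,2)] rho_singleton[OF j]
    by (simp add: rho_simps(2)[where u = "_ # _"])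
qed

text \<open>\<open>braid_rep\<close> picks the only value of \<open>word_rep\<close> on a braid class; this is what makes the value
  unique.\<close>
lemma rho_braid_eq:
  assumes "braid_eq n u v"
  shows "rho n u = rho n v"
  using assms
proof (induction rule: braid_eq.induct)
  case (cong u u' v v')
  then show ?case
    using braid_eq_words by (metis rho_append)
qed (use rho_cancel rho_far rho_braid in auto)

lemma braid_rep_class:
  assumes "u \<in> braid_words n"
  shows "braid_rep d k m R n (braid_class n u) = rho n u"
proof -
  have "rho n ` braid_class n u = {rho n u}"
    using assms rho_braid_eq braid_eq.refl by (fastforce simp: braid_class_def)
  then show ?thesis by (simp add: braid_rep_def)
qed

lemma width_add: "1 \<le> n \<Longrightarrow> width (n + p) = width n + m * p"
  using m_less_k by (cases n) (auto simp: rep_exp_def algebra_simps)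

text \<open>Trivial strands on either side of a braid only add identity factors on that side. On the
  right the generators keep their numbers, on the left they are shifted.\<close>
lemma rho_add_strands_right:
  assumes "u \<in> braid_words n" "1 \<le> n"
  shows "rho (n + p) u = rho n u \<otimes>\<^sub>m tid (m * p)"
  using assms(1)
proof (induction u)
  case Nil
  then show ?case by (simp only: rho_simps width_add[OF assms(2)] tensor_id_add)
next
  case (Cons x u)
  obtain i b where x: "x = (i, b)" by force
  with Cons.prems have i: "1 \<le> i" "i < n" and u: "u \<in> braid_words n"
    by (auto simp: braid_words_Cons)
  have "m * (n + p - i - 1) = m * (n - i - 1) + m * p"
    using i by (simp flip: distrib_left)
  then have "letter (n + p) x = letter n x \<otimes>\<^sub>m tid (m * p)"
    by (simp only: x letter_eq tensor_id_add kron_assoc)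
  then show ?case
    using Cons.IH[OF u] rho_carrier[OF u] letter_carrier[OF i, of b]
    by (simp add: rho_simps x kron_mult)
qed

lemma rho_add_strands_left:
  assumes "u \<in> braid_words n" "1 \<le> n"
  shows "rho (p + n) (shift p u) = tid (m * p) \<otimes>\<^sub>m rho n u"
  using assms(1)
proof (induction u)
  case Nil
  have "width (p + n) = m * p + width n"
    using width_add[OF assms(2), of p] by (simp add: add.commute)
  then show ?case by (simp only: rho_simps shift_simps tensor_id_add)
next
  case (Cons x u)
  obtain i b where x: "x = (i, b)" by force
  with Cons.prems have i: "1 \<le> i" "i < n" and u: "u \<in> braid_words n"
    by (auto simp: braid_words_Cons)
  have "m * (i + p - 1) = m * p + m * (i - 1)" "p + n - (i + p) - 1 = n - i - 1"
    using i by (simp_all add: add.commute flip: distrib_left)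
  then have "letter (p + n) (i + p, b) = tid (m * p) \<otimes>\<^sub>m letter n x"
    by (simp only: x letter_eq tensor_id_add kron_assoc)
  then show ?case
    using Cons.IH[OF u] rho_carrier[OF u] letter_carrier[OF i, of b]
    by (simp add: rho_simps x kron_mult)
qed

end

section \<open>Conjugating braids by powers of a Coxeter braid\<close>

lemma braid_eq_context:
  assumes "braid_eq n u v" "a \<in> braid_words n" "b \<in> braid_words n"
  shows "braid_eq n (a @ u @ b) (a @ v @ b)"
  using assms by (intro braid_eq.cong) (auto intro: braid_eq.refl)

text \<open>A word \<open>w\<close> slides past \<open>u\<close> if \<open>w u = u' w\<close> in the braid group. The next lemmas build such
  relations letter by letter: they can be combined along \<open>u\<close> and along \<open>w\<close>, and they extend
  from a generator to its inverse.\<close>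
lemma slide_append:
  assumes u: "braid_eq n (w @ u) (u' @ w)" and v: "braid_eq n (w @ v) (v' @ w)"
  shows "braid_eq n (w @ (u @ v)) ((u' @ v') @ w)"
proof -
  note words = braid_eq_words[OF u] braid_eq_words[OF v]
  have "braid_eq n (w @ u @ v) (u' @ w @ v)"
    using braid_eq_context[OF u, of "[]" v] words by simp
  also have "braid_eq n (u' @ w @ v) (u' @ v' @ w)"
    using braid_eq_context[OF v, of u' "[]"] words by simp
  finally show ?thesis by simp
qed

lemma slide_compose:
  assumes u: "braid_eq n (w @ u) (v @ w)" and v: "braid_eq n (w' @ v) (v' @ w')"
  shows "braid_eq n ((w' @ w) @ u) (v' @ (w' @ w))"
proof -
  note words = braid_eq_words[OF u] braid_eq_words[OF v]
  have "braid_eq n (w' @ w @ u) (w' @ v @ w)"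
    using braid_eq_context[OF u, of w' "[]"] words by simp
  also have "braid_eq n (w' @ v @ w) (v' @ w' @ w)"
    using braid_eq_context[OF v, of "[]" w] words by simp
  finally show ?thesis by simp
qed

lemma slide_inverse:
  assumes "braid_eq n (w @ [(i, True)]) ([(j, True)] @ w)"
  shows "braid_eq n (w @ [(i, b)]) ([(j, b)] @ w)"
proof (cases b)
  case False
  have w: "w \<in> braid_words n" and i: "i \<in> {1..<n}" and j: "j \<in> {1..<n}"
    using braid_eq_words[OF assms] by (auto simp: braid_words_Cons)
  then have letters: "[(i, c)] \<in> braid_words n" "[(j, c)] \<in> braid_words n" for c
    by (auto simp: braid_words_Cons)
  \<comment> \<open>Multiply \<open>w \<sigma>_i = \<sigma>_j w\<close> by \<open>\<sigma>_j\<close> inverse on the left and \<open>\<sigma>_i\<close> inverse on the right.\<close>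
  have "braid_eq n (w @ [(i, False)]) ([(j, False)] @ [(j, True)] @ w @ [(i, False)])"
    using braid_eq_context[OF braid_eq.sym[OF braid_eq.cancel[OF j, of False]],
        of "[]" "w @ [(i, False)]"] w letters by simp
  also have "braid_eq n ([(j, False)] @ [(j, True)] @ w @ [(i, False)])
      ([(j, False)] @ w @ [(i, True)] @ [(i, False)])"
    using braid_eq_context[OF braid_eq.sym[OF assms], of "[(j, False)]" "[(i, False)]"] letters
    by simp
  also have "braid_eq n ([(j, False)] @ w @ [(i, True)] @ [(i, False)])
      ([(j, False)] @ w)"
    using braid_eq_context[OF braid_eq.cancel[OF i, of True], of "[(j, False)] @ w" "[]"] w letters(2)
    by (simp add: braid_words_Cons)
  finally show ?thesis
    using False by simp
qed (use assms in simp)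

lemma slide_word:
  assumes "w \<in> braid_words n"
    and "\<And>i b. (i, b) \<in> set u \<Longrightarrow> braid_eq n (w @ [(i, True)]) ([(f i, True)] @ w)"
  shows "braid_eq n (w @ u) (map (\<lambda>(i, b). (f i, b)) u @ w)"
  using assms(2)
proof (induction u)
  case Nil
  then show ?case using assms(1) by (auto intro: braid_eq.refl)
next
  case (Cons x u)
  obtain i b where x: "x = (i, b)" by force
  have "braid_eq n (w @ [(i, b)]) ([(f i, b)] @ w)"
    by (rule slide_inverse, rule Cons.prems[of i b]) (simp add: x)
  moreover have "braid_eq n (w @ u) (map (\<lambda>(i, b). (f i, b)) u @ w)"
    by (rule Cons.IH, rule Cons.prems) (rule list.set_intros(2))
  ultimately have "braid_eq n (w @ ([(i, b)] @ u)) (([(f i, b)] @ map (\<lambda>(i, b). (f i, b)) u) @ w)"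
    by (rule slide_append)
  then show ?case by (simp add: x)
qed

lemma far_letters_commute:
  assumes "1 \<le> i" "i + 2 \<le> j" "j < n"
  shows "braid_eq n ([(i, b)] @ [(j, c)]) ([(j, c)] @ [(i, b)])"
proof -
  have "braid_eq n ([(i, True)] @ [(j, True)]) ([(j, True)] @ [(i, True)])"
    using braid_eq.far[of i n j] assms by simp
  then have "braid_eq n ([(i, True)] @ [(j, c)]) ([(j, c)] @ [(i, True)])"
    by (rule slide_inverse)
  \<comment> \<open>Read from right to left, the relation lets \<open>\<sigma>_j\<close> or its inverse slide past \<open>\<sigma>_i\<close>.\<close>
  then have "braid_eq n ([(j, c)] @ [(i, b)]) ([(i, b)] @ [(j, c)])"
    by (rule slide_inverse[OF braid_eq.sym])
  then show ?thesis by (rule braid_eq.sym)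
qed

lemma far_words_commute:
  assumes "u \<in> braid_words n" "v \<in> braid_words n"
    and "\<And>x y. x \<in> set u \<Longrightarrow> y \<in> set v \<Longrightarrow> fst x + 2 \<le> fst y"
  shows "braid_eq n (u @ v) (v @ u)"
proof -
  have letter: "braid_eq n (u @ [y]) ([y] @ u)" if y: "y \<in> set v" for y
    using assms(1,3)
  proof (induction u)
    case Nil
    then show ?case using y assms(2) by (auto intro!: braid_eq.refl simp: braid_words_def)
  next
    case (Cons x u)
    have "fst x + 2 \<le> fst y" "1 \<le> fst x" "fst y < n" "u \<in> braid_words n"
      using Cons.prems y assms(2) by (auto simp: braid_words_def)
    then have "braid_eq n ([x] @ [y]) ([y] @ [x])"
      using far_letters_commute[of "fst x" "fst y" n "snd x" "snd y"] by simp
    with Cons.IH[OF \<open>u \<in> _\<close>] have "braid_eq n (([x] @ u) @ [y]) ([y] @ ([x] @ u))"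
      using slide_compose Cons.prems y by (metis list.set_intros(2))
    then show ?case by simp
  qed
  show ?thesis
    using letter
  proof (induction v)
    case Nil
    then show ?case using assms(1) by (auto intro: braid_eq.refl)
  next
    case (Cons y v)
    then have "braid_eq n (u @ ([y] @ v)) (([y] @ v) @ u)"
      by (intro slide_append) simp_all
    then show ?case by simp
  qed
qed

text \<open>The positive word \<open>\<sigma>_a \<dots> \<sigma>_{b-1}\<close>. In particular \<open>ascent 1 n\<close> is the Coxeter braid, which
  moves one strand across all others.\<close>
definition ascent :: "nat \<Rightarrow> nat \<Rightarrow> braid_word" where
  "ascent a b = map (\<lambda>i. (i, True)) [a..<b]"

lemma ascent_words: "1 \<le> a \<Longrightarrow> b \<le> n \<Longrightarrow> ascent a b \<in> braid_words n"
  by (auto simp: ascent_def braid_words_def)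

lemma ascent_split: "a \<le> c \<Longrightarrow> c \<le> b \<Longrightarrow> ascent a b = ascent a c @ ascent c b"
  using upt_add_eq_append[of a c "b - c"] by (simp add: ascent_def)

lemma ascent_Suc: "ascent a (Suc a) = [(a, True)]"
  by (simp add: ascent_def)

text \<open>Writing the Coxeter braid \<open>\<delta>\<close> as \<open>A \<sigma>_i \<sigma>_{i+1} B\<close>, the letter \<open>\<sigma>_i\<close> commutes with \<open>B\<close> and
  \<open>\<sigma>_{i+1}\<close> with \<open>A\<close>, so that one braid relation in the middle gives
  \<open>\<delta> \<sigma>_i = \<sigma>_{i+1} \<delta>\<close>.\<close>
lemma ascent_slide:
  assumes "1 \<le> i" "Suc i < n"
  shows "braid_eq n (ascent 1 n @ [(i, True)]) ([(Suc i, True)] @ ascent 1 n)"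
proof -
  let ?A = "ascent 1 i" and ?B = "ascent (Suc (Suc i)) n"
  let ?s = "[(i, True)]" and ?t = "[(Suc i, True)]"
  have split: "ascent 1 n = ?A @ ?s @ ?t @ ?B"
    using assms ascent_split[of 1 i n] ascent_split[of i "Suc i" n]
      ascent_split[of "Suc i" "Suc (Suc i)" n]
    by (simp add: ascent_Suc)
  have words: "?A \<in> braid_words n" "?B \<in> braid_words n" "?s \<in> braid_words n" "?t \<in> braid_words n"
    using assms by (auto intro!: ascent_words simp: braid_words_Cons)
  have sB: "braid_eq n (?s @ ?B) (?B @ ?s)"
    using words by (intro far_words_commute) (auto simp: ascent_def)
  have At: "braid_eq n (?A @ ?t) (?t @ ?A)"
    using words by (intro far_words_commute) (auto simp: ascent_def)
  have sts: "braid_eq n (?s @ ?t @ ?s) (?t @ ?s @ ?t)"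
    using braid_eq.braid[of i n] assms by simp
  have "braid_eq n (?A @ ?s @ ?t @ ?B @ ?s) (?A @ ?s @ ?t @ ?s @ ?B)"
    using braid_eq_context[OF braid_eq.sym[OF sB], of "?A @ ?s @ ?t" "[]"] words
    by (simp only: append.assoc append_Nil2 braid_words_append braid_words_Nil simp_thms)
  also have "braid_eq n (?A @ ?s @ ?t @ ?s @ ?B) (?A @ ?t @ ?s @ ?t @ ?B)"
    using braid_eq_context[OF sts, of ?A ?B] words by simp
  also have "braid_eq n (?A @ ?t @ ?s @ ?t @ ?B) (?t @ ?A @ ?s @ ?t @ ?B)"
    using braid_eq_context[OF At, of "[]" "?s @ ?t @ ?B"] words
    by (simp only: append.assoc append_Nil braid_words_append braid_words_Nil simp_thms)
  finally show ?thesis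
    by (simp only: split append.assoc)
qed

text \<open>The last generator has no successor to be moved to by \<open>\<delta>\<close>, but \<open>\<delta>\<^sup>2\<close> moves it to the first one:
  \<open>\<delta> \<delta> \<sigma>_{n-1} = \<sigma>_1 (\<sigma>_2 \<dots> \<sigma>_{n-1}) \<delta> \<sigma>_{n-1} = \<sigma>_1 \<delta> (\<sigma>_1 \<dots> \<sigma>_{n-2}) \<sigma>_{n-1} = \<sigma>_1 \<delta> \<delta>\<close>.\<close>
lemma ascent_wrap:
  assumes "2 \<le> n"
  shows "braid_eq n ((ascent 1 n @ ascent 1 n) @ [(n - 1, True)]) ([(1, True)] @ (ascent 1 n @ ascent 1 n))"
proof -
  let ?D = "ascent 1 n" and ?last = "[(n - 1, True)]" and ?first = "[(1, True)]"
  have words: "?D \<in> braid_words n" "?first \<in> braid_words n" "?last \<in> braid_words n"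
    using assms by (auto intro!: ascent_words simp: braid_words_Cons)
  have first: "?D = ?first @ ascent 2 n"
    using ascent_split[of 1 2 n] ascent_Suc[of 1] assms by (simp add: numeral_2_eq_2)
  have last: "?D = ascent 1 (n - 1) @ ?last"
    using ascent_split[of 1 "n - 1" n] ascent_Suc[of "n - 1"] assms by simp
  have "braid_eq n (?D @ ascent 1 (n - 1))
      (map (\<lambda>(i, b). (Suc i, b)) (ascent 1 (n - 1)) @ ?D)"
    using words by (intro slide_word ascent_slide) (auto simp: ascent_def)
  moreover have "map (\<lambda>(i, b). (Suc i, b)) (ascent 1 (n - 1)) = ascent 2 n"
    using assms map_Suc_upt[of 1 "n - 1", symmetric]
    by (simp add: ascent_def comp_def numeral_2_eq_2)
  ultimately have "braid_eq n (ascent 2 n @ ?D) (?D @ ascent 1 (n - 1))"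
    by (metis braid_eq.sym)
  then have wrap: "braid_eq n (?first @ (ascent 2 n @ ?D) @ ?last)
      (?first @ (?D @ ascent 1 (n - 1)) @ ?last)"
    using words by (intro braid_eq_context)
  have left: "?first @ (ascent 2 n @ ?D) @ ?last = (?D @ ?D) @ ?last"
    by (subst (2) first) simp
  have right: "?first @ (?D @ ascent 1 (n - 1)) @ ?last = ?first @ (?D @ ?D)"
    by (subst (3) last) simp
  show ?thesis
    using wrap unfolding left right .
qed

abbreviation coxeter_power :: "nat \<Rightarrow> nat \<Rightarrow> braid_word" where
  "coxeter_power n p \<equiv> concat (replicate p (ascent 1 n))"

lemma coxeter_power_words: "coxeter_power n p \<in> braid_words n"
  by (induction p) (auto simp: ascent_words)

lemma coxeter_power_add: "coxeter_power n (p + q) = coxeter_power n p @ coxeter_power n q"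
  by (simp add: replicate_add)

lemma coxeter_power_slide:
  assumes "1 \<le> i" "i + p < n"
  shows "braid_eq n (coxeter_power n p @ [(i, True)]) ([(i + p, True)] @ coxeter_power n p)"
  using assms(2)
proof (induction p)
  case 0
  then show ?case using assms(1) by (auto intro!: braid_eq.refl simp: braid_words_Cons)
next
  case (Suc p)
  have "braid_eq n (ascent 1 n @ [(i + p, True)]) ([(Suc (i + p), True)] @ ascent 1 n)"
    using assms(1) Suc.prems by (intro ascent_slide) auto
  then have "braid_eq n ((ascent 1 n @ coxeter_power n p) @ [(i, True)])
      ([(Suc (i + p), True)] @ (ascent 1 n @ coxeter_power n p))"
    using Suc by (intro slide_compose[where v = "[(i + p, True)]"]) auto
  then show ?case by simp
qed

text \<open>Of the \<open>n_2\<close> factors \<open>\<delta>\<close>, the first \<open>n_2 - 1 - i\<close> to act move \<open>\<sigma>_{i+n_1}\<close> up to the last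
  generator, two move that to \<open>\<sigma>_1\<close>, and the remaining \<open>i - 1\<close> move it up to \<open>\<sigma>_i\<close>.\<close>
lemma coxeter_power_wrap:
  assumes "1 \<le> i" "i < n2" "1 \<le> n1"
  shows "braid_eq (n1 + n2) (coxeter_power (n1 + n2) n2 @ [(i + n1, True)])
    ([(i, True)] @ coxeter_power (n1 + n2) n2)"
proof -
  let ?n = "n1 + n2" and ?q = "n2 - 1 - i"
  let ?D = "ascent 1 ?n"
  have up: "braid_eq ?n (coxeter_power ?n ?q @ [(i + n1, True)])
      ([(?n - 1, True)] @ coxeter_power ?n ?q)"
    using coxeter_power_slide[of "i + n1" ?q ?n] assms by simp
  have round: "braid_eq ?n ((?D @ ?D) @ [(?n - 1, True)]) ([(1, True)] @ (?D @ ?D))"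
    using assms by (intro ascent_wrap) auto
  have down: "braid_eq ?n (coxeter_power ?n (i - 1) @ [(1, True)])
      ([(i, True)] @ coxeter_power ?n (i - 1))"
    using coxeter_power_slide[of 1 "i - 1" ?n] assms by simp
  have two: "coxeter_power ?n 2 = ?D @ ?D"
    by (simp add: numeral_2_eq_2)
  have sum: "(i - 1) + (2 + ?q) = n2"
    using assms by simp
  have "coxeter_power ?n ((i - 1) + (2 + ?q))
      = coxeter_power ?n (i - 1) @ (?D @ ?D) @ coxeter_power ?n ?q"
    by (simp only: coxeter_power_add two)
  then have split: "coxeter_power ?n n2
      = coxeter_power ?n (i - 1) @ (?D @ ?D) @ coxeter_power ?n ?q"
    by (simp only: sum)
  show ?thesis
    unfolding split by (rule slide_compose[OF slide_compose[OF up round] down])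
qed

text \<open>Two braids side by side can be exchanged by conjugation: \<open>\<delta>\<close> to the power \<open>n_2\<close> moves the
  generators of the left braid up by \<open>n_2\<close> and those of the right braid, around the end, down
  by \<open>n_1\<close>. The order of the two commuting pieces is then restored.\<close>
lemma juxtaposition_swap:
  assumes u: "u \<in> braid_words n1" and v: "v \<in> braid_words n2" and pos: "1 \<le> n1" "1 \<le> n2"
  shows "braid_eq (n1 + n2) (coxeter_power (n1 + n2) n2 @ (u @ shift n1 v))
    ((v @ shift n2 u) @ coxeter_power (n1 + n2) n2)"
proof -
  let ?n = "n1 + n2"
  let ?D = "coxeter_power ?n n2"
  have u_slide: "braid_eq ?n (?D @ u) (shift n2 u @ ?D)"
    unfolding shift_def
    using u by (intro slide_word coxeter_power_words coxeter_power_slide) (auto simp: braid_words_def)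
  have "braid_eq ?n (?D @ shift n1 v) (map (\<lambda>(i, b). (i - n1, b)) (shift n1 v) @ ?D)"
  proof (rule slide_word[OF coxeter_power_words])
    fix i b
    assume "(i, b) \<in> set (shift n1 v)"
    then obtain j where "i = j + n1" "1 \<le> j" "j < n2"
      using v by (auto simp: shift_def braid_words_def)
    then show "braid_eq ?n (?D @ [(i, True)]) ([(i - n1, True)] @ ?D)"
      using coxeter_power_wrap[of j n2 n1] pos by simp
  qed
  moreover have "map (\<lambda>(i, b). (i - n1, b)) (shift n1 v) = v"
    by (induction v) auto
  ultimately have "braid_eq ?n (?D @ shift n1 v) (v @ ?D)"
    by simp
  with u_slide have "braid_eq ?n (?D @ (u @ shift n1 v)) ((shift n2 u @ v) @ ?D)"
    by (rule slide_append)
  also have "braid_eq ?n ((shift n2 u @ v) @ ?D) ((v @ shift n2 u) @ ?D)"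
  proof -
    have "v \<in> braid_words ?n" "shift n2 u \<in> braid_words ?n"
      using u v by (auto intro: braid_words_mono shift_words)
    moreover have "fst x + 2 \<le> fst y" if "x \<in> set v" "y \<in> set (shift n2 u)" for x y
      using that u v by (force simp: shift_def braid_words_def)
    ultimately have "braid_eq ?n (v @ shift n2 u) (shift n2 u @ v)"
      by (rule far_words_commute)
    from braid_eq_context[OF braid_eq.sym[OF this] braid_words_Nil coxeter_power_words]
    show ?thesis by (simp only: append_Nil)
  qed
  finally show ?thesis .
qed

section \<open>Disjoint union of links\<close>

lemma braid_carrierE:
  assumes "\<xi> \<in> carrier (braid_group n)"
  obtains u where "u \<in> braid_words n" "\<xi> = braid_class n u"
  using assms by (auto simp: braid_group_def)

lemma braid_class_carrier [simp]:
  "u \<in> braid_words n \<Longrightarrow> braid_class n u \<in> carrier (braid_group n)"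
  by (simp add: braid_group_def)

lemma braid_class_eqD:
  "u \<in> braid_words n \<Longrightarrow> braid_class n u = braid_class n v \<Longrightarrow> braid_eq n u v"
  by (auto simp: braid_class_def intro: braid_eq.refl braid_eq.sym)

lemma juxtapose_class:
  assumes "u \<in> braid_words n1" "v \<in> braid_words n2"
  shows "juxtapose n1 n2 (braid_class n1 u) (braid_class n2 v) = braid_class (n1 + n2) (u @ shift n1 v)"
proof -
  have "braid_eq (n1 + n2) (u @ shift n1 v) w"
    if "braid_eq n1 u u'" "braid_eq n2 v v'" "braid_eq (n1 + n2) (u' @ shift n1 v') w" for u' v' w
    using that by (meson braid_eq.cong braid_eq.trans braid_eq_mono braid_eq_shift le_add1 order_refl)
  then show ?thesis
    using assms by (auto simp: juxtapose_def braid_class_def simp flip: shift_def intro: braid_eq.refl)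
qed

lemma braid_incl_class:
  assumes "u \<in> braid_words n"
  shows "braid_incl n (braid_class n u) = braid_class (Suc n) u"
proof -
  have "braid_eq (Suc n) u w" if "braid_eq n u u'" "braid_eq (Suc n) u' w" for u' w
    using that by (meson braid_eq.trans braid_eq_mono le_SucI order_refl)
  then show ?thesis
    using assms by (auto simp: braid_incl_def braid_class_def intro: braid_eq.refl)
qed

lemma juxtaposition_words:
  "u \<in> braid_words n1 \<Longrightarrow> v \<in> braid_words n2 \<Longrightarrow> u @ shift n1 v \<in> braid_words (n1 + n2)"
  by (auto intro: braid_words_mono shift_words)

text \<open>Conjugacy as a relation between words, which avoids writing down the inverse of the
  conjugating element.\<close>
lemma markov_eq_conjugate:
  assumes "1 \<le> n" "braid_eq n (u @ w) (w @ v)"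
  shows "markov_eq (n, braid_class n u) (n, braid_class n v)"
proof -
  interpret group "braid_group n" by (rule braid_group_is_group)
  let ?c = "braid_class n"
  have words: "u \<in> braid_words n" "v \<in> braid_words n" "w \<in> braid_words n"
    using braid_eq_words[OF assms(2)] by auto
  have "?c u \<otimes>\<^bsub>braid_group n\<^esub> ?c w = ?c w \<otimes>\<^bsub>braid_group n\<^esub> ?c v"
    using braid_class_eq[OF assms(2)] words by (simp add: braid_class_mult)
  then have "inv\<^bsub>braid_group n\<^esub> ?c w \<otimes>\<^bsub>braid_group n\<^esub> ?c u \<otimes>\<^bsub>braid_group n\<^esub> ?c w = ?c v"
    using words by (simp add: m_assoc inv_solve_left')
  then show ?thesis
    using markov_eq.conj[OF assms(1), of "?c u" "?c w"] words by simp
qed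

lemma markov_eq_braids:
  assumes "markov_eq x y"
  shows "x \<in> braids" "y \<in> braids"
proof -
  have "x \<in> braids \<and> y \<in> braids"
    using assms
  proof (induction rule: markov_eq.induct)
    case (conj n \<xi> \<eta>)
    interpret group "braid_group n" by (rule braid_group_is_group)
    show ?case using conj by (simp add: braids_def)
  next
    case (stab n \<xi> b)
    interpret group "braid_group (Suc n)" by (rule braid_group_is_group)
    obtain u where "u \<in> braid_words n" "\<xi> = braid_class n u"
      using stab(2) by (rule braid_carrierE)
    then have "braid_incl n \<xi> \<in> carrier (braid_group (Suc n))"
      by (auto simp: braid_incl_class intro!: braid_class_carrier braid_words_mono[of u n])
    then show ?case using stab by (simp add: braids_def braid_words_Cons)
  qed auto
  then show "x \<in> braids" "y \<in> braids" by auto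
qed

text \<open>A Markov move on the right-hand braid is a Markov move on the juxtaposition: the shifted
  conjugating word commutes with the left-hand braid, and the last strand of the right-hand
  braid is the last strand of the whole. Moves on the left-hand braid lack the second
  property, which is why the two sides have to be exchanged in \<open>markov_eq_juxtapose\<close>.\<close>
lemma markov_eq_juxtapose_right:
  assumes "markov_eq x y" "1 \<le> n" "a \<in> braid_words n"
  shows "markov_eq (n + fst x, juxtapose n (fst x) (braid_class n a) (snd x))
    (n + fst y, juxtapose n (fst y) (braid_class n a) (snd y))"
  using assms(1)
proof (induction rule: markov_eq.induct)
  case (refl x)
  then obtain l u where "x = (l, braid_class l u)" "1 \<le> l" "u \<in> braid_words l"
    by (auto simp: braids_def elim: braid_carrierE)
  then show ?case
    using assms(2,3)
    by (auto intro!: markov_eq.refl simp: braids_def juxtapose_class juxtaposition_words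
        simp del: braid_words_append)
next
  case (conj l \<xi> \<eta>)
  interpret group "braid_group l" by (rule braid_group_is_group)
  obtain u w where u: "u \<in> braid_words l" "\<xi> = braid_class l u"
    and w: "w \<in> braid_words l" "\<eta> = braid_class l w"
    using conj(2,3) by (meson braid_carrierE)
  have "inv\<^bsub>braid_group l\<^esub> \<eta> \<otimes>\<^bsub>braid_group l\<^esub> \<xi> \<otimes>\<^bsub>braid_group l\<^esub> \<eta> \<in> carrier (braid_group l)"
    using conj by simp
  then obtain v where v: "v \<in> braid_words l"
    "inv\<^bsub>braid_group l\<^esub> \<eta> \<otimes>\<^bsub>braid_group l\<^esub> \<xi> \<otimes>\<^bsub>braid_group l\<^esub> \<eta> = braid_class l v"
    by (rule braid_carrierE)
  have "\<xi> \<otimes>\<^bsub>braid_group l\<^esub> \<eta> = \<eta> \<otimes>\<^bsub>braid_group l\<^esub> braid_class l v"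
    using conj(2,3) by (simp add: m_assoc flip: v(2)) (simp flip: m_assoc)
  then have "braid_eq l (u @ w) (w @ v)"
    using u w v(1) by (intro braid_class_eqD) (simp_all add: braid_class_mult)
  then have conj_shift: "braid_eq (n + l) (shift n u @ shift n w) (shift n w @ shift n v)"
    using braid_eq_shift[of l "u @ w" "w @ v" n "n + l"] by simp
  have words: "a \<in> braid_words (n + l)" "shift n u \<in> braid_words (n + l)"
    "shift n v \<in> braid_words (n + l)" "shift n w \<in> braid_words (n + l)"
    using assms(3) u(1) v(1) w(1) by (auto intro: braid_words_mono shift_words)
  have "fst x + 2 \<le> fst y" if "x \<in> set a" "y \<in> set (shift n w)" for x y
    using that assms(3) w(1) by (force simp: shift_def braid_words_def)
  then have commute: "braid_eq (n + l) (a @ shift n w) (shift n w @ a)"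
    by (rule far_words_commute[OF words(1,4)])
  have "braid_eq (n + l) (a @ shift n u @ shift n w) (a @ shift n w @ shift n v)"
    using braid_eq_context[OF conj_shift, of a "[]"] words by simp
  also have "braid_eq (n + l) (a @ shift n w @ shift n v)
      (shift n w @ a @ shift n v)"
    using braid_eq_context[OF commute, of "[]" "shift n v"] words by simp
  finally have "markov_eq (n + l, braid_class (n + l) (a @ shift n u))
      (n + l, braid_class (n + l) (a @ shift n v))"
    using assms(2) by (intro markov_eq_conjugate[where w = "shift n w"]) simp_all
  then show ?case
    using assms(3) u v by (simp add: juxtapose_class)
next
  case (stab l \<xi> b)
  obtain u where u: "u \<in> braid_words l" "\<xi> = braid_class l u"
    using stab(2) by (rule braid_carrierE)
  have last: "u \<in> braid_words (Suc l)" "[(l, b)] \<in> braid_words (Suc l)"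
    "[(n + l, b)] \<in> braid_words (Suc (n + l))" "a @ shift n u \<in> braid_words (n + l)"
    "a @ shift n u \<in> braid_words (Suc (n + l))"
    using u(1) stab(1) assms(3) juxtaposition_words[OF assms(3) u(1)]
    by (auto simp: braid_words_Cons simp del: braid_words_append intro: braid_words_mono)
  have "juxtapose n (Suc l) (braid_class n a)
      (braid_incl l \<xi> \<otimes>\<^bsub>braid_group (Suc l)\<^esub> braid_class (Suc l) [(l, b)])
    = juxtapose n (Suc l) (braid_class n a) (braid_class (Suc l) (u @ [(l, b)]))"
    using u last by (simp only: braid_incl_class braid_class_mult)
  also have "\<dots> = braid_class (Suc (n + l)) (a @ shift n (u @ [(l, b)]))"
    using assms(3) last by (subst juxtapose_class) auto
  also have "\<dots> = braid_class (Suc (n + l)) ((a @ shift n u) @ [(n + l, b)])"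
    by (simp add: add.commute)
  also have "\<dots> = braid_incl (n + l) (juxtapose n l (braid_class n a) \<xi>)
      \<otimes>\<^bsub>braid_group (Suc (n + l))\<^esub> braid_class (Suc (n + l)) [(n + l, b)]"
    using assms(3) u last by (simp only: juxtapose_class braid_incl_class braid_class_mult)
  finally show ?case
    using markov_eq.stab[of "n + l" "juxtapose n l (braid_class n a) \<xi>" b]
      assms(2,3) u last by (simp add: juxtapose_class)
qed (auto intro: markov_eq.intros)

lemma markov_eq_swap:
  assumes "1 \<le> n1" "1 \<le> n2" "u \<in> braid_words n1" "v \<in> braid_words n2"
  shows "markov_eq (n1 + n2, braid_class (n1 + n2) (u @ shift n1 v))
    (n2 + n1, braid_class (n2 + n1) (v @ shift n2 u))"
proof -
  have "markov_eq (n1 + n2, braid_class (n1 + n2) (v @ shift n2 u))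
      (n1 + n2, braid_class (n1 + n2) (u @ shift n1 v))"
    using assms(1) braid_eq.sym[OF juxtaposition_swap[OF assms(3,4,1,2)]]
    by (intro markov_eq_conjugate) simp_all
  then show ?thesis
    by (simp add: add.commute markov_eq.sym)
qed

lemma markov_eq_juxtapose:
  assumes x: "markov_eq (n1, \<xi>1) (l1, \<eta>1)" and y: "markov_eq (n2, \<xi>2) (l2, \<eta>2)"
  shows "markov_eq (n1 + n2, juxtapose n1 n2 \<xi>1 \<xi>2) (l1 + l2, juxtapose l1 l2 \<eta>1 \<eta>2)"
proof -
  obtain u1 v1 u2 v2 where
    words: "u1 \<in> braid_words n1" "v1 \<in> braid_words l1" "u2 \<in> braid_words n2" "v2 \<in> braid_words l2"
    and cls: "\<xi>1 = braid_class n1 u1" "\<eta>1 = braid_class l1 v1"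
      "\<xi>2 = braid_class n2 u2" "\<eta>2 = braid_class l2 v2"
    and pos: "1 \<le> n1" "1 \<le> l1" "1 \<le> n2" "1 \<le> l2"
    using markov_eq_braids[OF x] markov_eq_braids[OF y]
    by (auto simp: braids_def elim!: braid_carrierE)
  have "markov_eq (n1 + n2, juxtapose n1 n2 \<xi>1 \<xi>2) (n1 + l2, juxtapose n1 l2 \<xi>1 \<eta>2)"
    using markov_eq_juxtapose_right[OF y pos(1) words(1)] by (simp add: cls)
  also have "markov_eq (n1 + l2, juxtapose n1 l2 \<xi>1 \<eta>2)
      (l2 + n1, juxtapose l2 n1 \<eta>2 \<xi>1)"
    using markov_eq_swap[OF pos(1,4) words(1,4)] words by (simp add: cls juxtapose_class)
  also have "markov_eq (l2 + n1, juxtapose l2 n1 \<eta>2 \<xi>1)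
      (l2 + l1, juxtapose l2 l1 \<eta>2 \<eta>1)"
    using markov_eq_juxtapose_right[OF x pos(4) words(4)] by (simp add: cls)
  also have "markov_eq (l2 + l1, juxtapose l2 l1 \<eta>2 \<eta>1)
      (l1 + l2, juxtapose l1 l2 \<eta>1 \<eta>2)"
    using markov_eq_swap[OF pos(4,2) words(4,2)] words by (simp add: cls juxtapose_class)
  finally show ?thesis .
qed

lemma braid_closure_eq: "markov_eq (n, \<xi>) (l, \<eta>) \<Longrightarrow> braid_closure n \<xi> = braid_closure l \<eta>"
  by (auto simp: braid_closure_def intro: markov_eq.sym markov_eq.trans)

text \<open>\<open>disjoint_union\<close> collects the closures of the juxtapositions of all pairs of representatives;
  by \<open>markov_eq_juxtapose\<close> they are all the same set.\<close>
lemma disjoint_union_closure: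
  assumes "1 \<le> n1" "1 \<le> n2" "\<xi>1 \<in> carrier (braid_group n1)" "\<xi>2 \<in> carrier (braid_group n2)"
  shows "disjoint_union (braid_closure n1 \<xi>1) (braid_closure n2 \<xi>2)
    = braid_closure (n1 + n2) (juxtapose n1 n2 \<xi>1 \<xi>2)"
proof -
  have refl: "(n1, \<xi>1) \<in> braid_closure n1 \<xi>1" "(n2, \<xi>2) \<in> braid_closure n2 \<xi>2"
    using assms by (auto simp: braid_closure_def braids_def intro: markov_eq.refl)
  have "braid_closure (l1 + l2) (juxtapose l1 l2 \<eta>1 \<eta>2)
      = braid_closure (n1 + n2) (juxtapose n1 n2 \<xi>1 \<xi>2)"
    if "(l1, \<eta>1) \<in> braid_closure n1 \<xi>1" "(l2, \<eta>2) \<in> braid_closure n2 \<xi>2" for l1 l2 \<eta>1 \<eta>2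
    using that markov_eq_juxtapose braid_closure_eq by (simp add: braid_closure_def) metis
  then show ?thesis
    using refl unfolding disjoint_union_def by fast
qed

section \<open>Traces of juxtaposed braids\<close>

lemma writhe_class:
  assumes "u \<in> braid_words n"
  shows "writhe (braid_class n u) = word_writhe u"
proof -
  have "word_writhe u = word_writhe v" if "braid_eq n u v" for u v
    using that by (induction rule: braid_eq.induct) (auto simp: word_writhe_def)
  then have "word_writhe ` braid_class n u = {word_writhe u}"
    using assms braid_eq.refl by (fastforce simp: braid_class_def)
  then show ?thesis by (simp add: writhe_def)
qed

lemma word_writhe_juxtaposition: "word_writhe (u @ shift s v) = word_writhe u + word_writhe v"
  by (induction v) (auto simp: word_writhe_def shift_def case_prod_beta comp_def)

locale gYB_weight = gYB +
  fixes \<mu> :: "complex mat"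
  assumes weight [simp]: "\<mu> \<in> carrier_mat d d"
begin

text \<open>\<open>T_braid\<close> without its normalisation by powers of \<open>\<alpha>\<close> and \<open>\<beta>\<close>.\<close>
definition weighted_trace :: "nat \<Rightarrow> braid_word \<Rightarrow> complex" where
  "weighted_trace n u = mat_trace (rho n u * tensor_power \<mu> (width n))"

lemma tensor_power_dim [simp]:
  "dim_row (tensor_power \<mu> n) = d ^ n" "dim_col (tensor_power \<mu> n) = d ^ n"
  using tensor_power_carrier[OF weight, of n] unfolding carrier_mat_def by auto

lemma rho_dim [simp]:
  "u \<in> braid_words n \<Longrightarrow> dim_row (rho n u) = d ^ width n"
  "u \<in> braid_words n \<Longrightarrow> dim_col (rho n u) = d ^ width n"
  using rho_carrier[of u n] unfolding carrier_mat_def by auto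

lemma weighted_trace_add_strands:
  assumes "u \<in> braid_words n" "1 \<le> n"
  shows "weighted_trace (n + p) u = weighted_trace n u * mat_trace \<mu> ^ (m * p)"
proof -
  have "rho (n + p) u * tensor_power \<mu> (width (n + p))
      = (rho n u * tensor_power \<mu> (width n)) \<otimes>\<^sub>m tensor_power \<mu> (m * p)"
    using assms(1) left_mult_one_mat[OF tensor_power_carrier[OF weight]]
    by (simp add: rho_add_strands_right[OF assms] width_add[OF assms(2)] tensor_power_add kron_mult)
  moreover have "rho n u * tensor_power \<mu> (width n) \<in> carrier_mat (d ^ width n) (d ^ width n)"
    using rho_carrier[OF assms(1)] tensor_power_carrier[OF weight] by (rule mult_carrier_mat)
  ultimately show ?thesis
    using mat_trace_tensor_power[OF weight]
    by (simp add: weighted_trace_def mat_trace_kron[OF _ tensor_power_carrier[OF weight]])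
qed

text \<open>With \<open>p\<close> trivial strands between \<open>u\<close> and \<open>v\<close>, and \<open>k \<le> m p + 2 m\<close>, the operators of \<open>u\<close> and \<open>v\<close>
  act on disjoint blocks of tensor factors, and on the \<open>m p + 2 m - k\<close> factors between them only
  \<open>\<mu>\<close> acts.\<close>
lemma weighted_trace_split:
  assumes u: "u \<in> braid_words n1" "1 \<le> n1" and v: "v \<in> braid_words n2" "1 \<le> n2"
    and gap: "k \<le> m * p + 2 * m"
  shows "weighted_trace (n1 + (p + n2)) (u @ shift (n1 + p) v)
    = weighted_trace n1 u * mat_trace \<mu> ^ (m * p + 2 * m - k) * weighted_trace n2 v"
proof -
  let ?n = "n1 + (p + n2)" and ?g = "m * p + 2 * m - k"
  let ?A = "rho n1 u" and ?B = "rho n2 v" and ?e1 = "width n1" and ?e2 = "width n2"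
  have right: "m * (p + n2) = ?g + ?e2" and left: "m * (n1 + p) = ?e1 + ?g"
  proof -
    obtain i j where "n1 = Suc i" "n2 = Suc j"
      using u(2) v(2) by (metis One_nat_def Suc_le_D)
    then show "m * (p + n2) = ?g + ?e2" "m * (n1 + p) = ?e1 + ?g"
      using gap m_less_k by (simp_all add: rep_exp_def algebra_simps)
  qed
  have width: "width ?n = ?e1 + (?g + ?e2)"
    using width_add[OF u(2), of "p + n2"] right by simp
  have words: "u \<in> braid_words ?n" "shift (n1 + p) v \<in> braid_words ?n"
    using u v by (auto intro: braid_words_mono shift_words)
  have "rho ?n (u @ shift (n1 + p) v)
      = (?A \<otimes>\<^sub>m tid (m * (p + n2))) * (tid (m * (n1 + p)) \<otimes>\<^sub>m ?B)"
    using rho_append[OF words] rho_add_strands_right[OF u, of "p + n2"]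
      rho_add_strands_left[OF v, of "n1 + p"] by (simp add: add.assoc)
  also have "\<dots> = (?A \<otimes>\<^sub>m tid ?g \<otimes>\<^sub>m tid ?e2) * (tid ?e1 \<otimes>\<^sub>m tid ?g \<otimes>\<^sub>m ?B)"
    by (simp only: left right tensor_id_add kron_assoc)
  also have "\<dots> = ?A \<otimes>\<^sub>m tid ?g \<otimes>\<^sub>m ?B"
    using u v rho_carrier by (simp add: kron_mult)
  finally have "rho ?n (u @ shift (n1 + p) v) * tensor_power \<mu> (width ?n)
      = (?A * tensor_power \<mu> ?e1) \<otimes>\<^sub>m tensor_power \<mu> ?g \<otimes>\<^sub>m (?B * tensor_power \<mu> ?e2)"
    using u v left_mult_one_mat[OF tensor_power_carrier[OF weight]]
    by (simp add: width tensor_power_add kron_mult)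
  moreover have A: "?A * tensor_power \<mu> ?e1 \<in> carrier_mat (d ^ ?e1) (d ^ ?e1)"
    and B: "?B * tensor_power \<mu> ?e2 \<in> carrier_mat (d ^ ?e2) (d ^ ?e2)"
    using rho_carrier[OF u(1)] rho_carrier[OF v(1)] tensor_power_carrier[OF weight]
    by (auto intro: mult_carrier_mat)
  ultimately show ?thesis
    using mat_trace_tensor_power[OF weight]
      mat_trace_kron[OF A kron_carrier[OF tensor_power_carrier[OF weight, of ?g] B]]
      mat_trace_kron[OF tensor_power_carrier[OF weight, of ?g] B]
    by (simp add: weighted_trace_def)
qed

lemma T_braid_class:
  assumes "u \<in> braid_words n"
  shows "T_braid d k m R \<mu> \<alpha> \<beta> n (braid_class n u)
    = \<alpha> powi (- word_writhe u) * \<beta> powi (- int n) * weighted_trace n u"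
  by (simp add: T_braid_def writhe_class[OF assms] braid_rep_class[OF assms] weighted_trace_def)

text \<open>When \<open>k > 2 m\<close>, the same link is computed with \<open>k\<close> additional trivial strands in two positions:
  to the right of both braids, where they multiply the trace by a power of \<open>tr(\<mu>)\<close>, and between
  the braids, where they separate them.\<close>
lemma weighted_trace_juxtaposition:
  assumes T: "associated_invariant d k m R \<mu> \<alpha> \<beta> T" and "\<alpha> \<noteq> 0" "\<beta> \<noteq> 0" "0 < m"
    and t: "2 * m < k \<longrightarrow> mat_trace \<mu> \<noteq> 0"
    and u: "u \<in> braid_words n1" "1 \<le> n1" and v: "v \<in> braid_words n2" "1 \<le> n2"
  shows "weighted_trace (n1 + n2) (u @ shift n1 v)
    = mat_trace \<mu> powi (2 * int m - int k) * weighted_trace n1 u * weighted_trace n2 v"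
proof (cases "k \<le> 2 * m")
  case True
  have "mat_trace \<mu> powi (2 * int m - int k) = mat_trace \<mu> ^ (2 * m - k)"
    using True by (simp add: power_int_def nat_diff_distrib nat_mult_distrib)
  then show ?thesis
    using weighted_trace_split[OF u v, of 0] True by simp
next
  case False
  let ?t = "mat_trace \<mu>" and ?w = "u @ shift n1 v" and ?w' = "u @ shift (n1 + k) v"
  let ?n = "n1 + (n2 + k)" and ?n' = "n1 + (k + n2)"
  \<comment> \<open>Since \<open>m\<close> is positive, \<open>k\<close> strands suffice to separate the braids.\<close>
  have nz: "?t \<noteq> 0" and k: "1 \<le> k" and gap: "k \<le> m * k + 2 * m"
    using False t \<open>0 < m\<close> by (auto intro: trans_le_add1)
  have w: "?w \<in> braid_words (n1 + n2)" "?w \<in> braid_words ?n" "?w' \<in> braid_words ?n'"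
    using u v by (auto intro: braid_words_mono shift_words)
  \<comment> \<open>The trivial strands are exchanged with \<open>v\<close>, as the juxtaposition with an empty word.\<close>
  have "markov_eq (n2 + k, braid_class (n2 + k) v) (k + n2, braid_class (k + n2) (shift k v))"
    using markov_eq_swap[OF v(2) k v(1), of "[]"] by simp
  from markov_eq_juxtapose_right[OF this u(2,1)]
  have "markov_eq (?n, braid_class ?n ?w) (?n', braid_class ?n' ?w')"
    using u v by (simp add: juxtapose_class braid_words_mono shift_words add.commute)
  then have "T_braid d k m R \<mu> \<alpha> \<beta> ?n (braid_class ?n ?w)
      = T_braid d k m R \<mu> \<alpha> \<beta> ?n' (braid_class ?n' ?w')"
    using T w u(2) braid_closure_eq unfolding associated_invariant_def
    by (metis braid_class_carrier trans_le_add1)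
  then have "weighted_trace ?n ?w = weighted_trace ?n' ?w'"
    using \<open>\<alpha> \<noteq> 0\<close> \<open>\<beta> \<noteq> 0\<close> T_braid_class[OF w(2)] T_braid_class[OF w(3)]
    by (simp add: word_writhe_juxtaposition add.commute[of k])
  moreover have "weighted_trace ?n ?w = weighted_trace (n1 + n2) ?w * ?t ^ (m * k)"
    using weighted_trace_add_strands[OF w(1), of k] u(2) by (simp add: add.assoc)
  ultimately have "weighted_trace (n1 + n2) ?w * ?t ^ (m * k)
      = weighted_trace n1 u * ?t ^ (m * k + 2 * m - k) * weighted_trace n2 v"
    using weighted_trace_split[OF u v gap] by simp
  moreover have "?t ^ (m * k + 2 * m - k) = ?t powi (2 * int m - int k) * ?t ^ (m * k)"
  proof -
    have "?t ^ (m * k + 2 * m - k) = ?t powi int (m * k + 2 * m - k)"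
      by (rule power_int_of_nat[symmetric])
    also have "int (m * k + 2 * m - k) = (2 * int m - int k) + int (m * k)"
      using gap by (simp add: of_nat_diff)
    also have "?t powi \<dots> = ?t powi (2 * int m - int k) * ?t powi int (m * k)"
      by (rule power_int_add[OF disjI1[OF nz]])
    finally show ?thesis by (simp only: power_int_of_nat)
  qed
  ultimately show ?thesis
    using nz by (simp add: algebra_simps)
qed

end

theorem theorem3p2p1:
  fixes d k m :: nat
    and R \<mu> :: "complex mat"
    and \<alpha> \<beta> :: complex
    and T :: "link \<Rightarrow> complex"
    and L1 L2 :: link
  assumes "EgYB_operator d k m R \<mu> \<alpha> \<beta>"
    and "associated_invariant d k m R \<mu> \<alpha> \<beta> T"
    and "2 * m < k \<longrightarrow> mat_trace \<mu> \<noteq> 0"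
    and "L1 \<in> oriented_links" and "L2 \<in> oriented_links"
  shows "T (disjoint_union L1 L2) = mat_trace \<mu> powi (2 * int m - int k) * T L1 * T L2"
proof -
  interpret gYB_weight d k m R \<mu>
    using assms(1) by unfold_locales (auto simp: EgYB_operator_def)
  have nz: "0 < m" "\<alpha> \<noteq> 0" "\<beta> \<noteq> 0"
    using assms(1) by (auto simp: EgYB_operator_def)
  obtain n1 u n2 v where u: "u \<in> braid_words n1" "1 \<le> n1" and L1: "L1 = braid_closure n1 (braid_class n1 u)"
    and v: "v \<in> braid_words n2" "1 \<le> n2" and L2: "L2 = braid_closure n2 (braid_class n2 v)"
    using assms(4,5) by (auto simp: oriented_links_def elim!: braid_carrierE)
  have T: "T (braid_closure n (braid_class n w))
      = \<alpha> powi (- word_writhe w) * \<beta> powi (- int n) * weighted_trace n w"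
    if "1 \<le> n" "w \<in> braid_words n" for n w
    using assms(2) that T_braid_class by (simp add: associated_invariant_def)
  have w: "u @ shift n1 v \<in> braid_words (n1 + n2)"
    using u v by (intro juxtaposition_words)
  have "disjoint_union L1 L2 = braid_closure (n1 + n2) (braid_class (n1 + n2) (u @ shift n1 v))"
    using u v by (simp add: L1 L2 disjoint_union_closure juxtapose_class)
  then have "T (disjoint_union L1 L2) = \<alpha> powi (- word_writhe u + - word_writhe v) *
      \<beta> powi (- int n1 + - int n2) * weighted_trace (n1 + n2) (u @ shift n1 v)"
    using T[OF _ w] u(2) by (simp add: word_writhe_juxtaposition)
  also have "\<dots> = mat_trace \<mu> powi (2 * int m - int k) * T L1 * T L2"
    unfolding weighted_trace_juxtaposition[OF assms(2) nz(2,3,1) assms(3) u v]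
      L1 L2 T[OF u(2,1)] T[OF v(2,1)]
    unfolding power_int_add[OF disjI1[OF nz(2)]] power_int_add[OF disjI1[OF nz(3)]]
    by (simp only: ac_simps)
  finally show ?thesis .
qed

end
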